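(* Let $X$ be an $\mathbb R^d$-valued compound Poisson process on $[0,1)$ with intensity $\lambda>0$ and jump distribution that of $Z^{(1)}$ (with $\mathbb P(Z^{(1)}=0)=0$), let $s>0$, and assume that the distribution of $Z^{(1)}$ has a nonzero absolutely continuous component (with respect to Lebesgue measure on $\mathbb R^d$). Then $$-\log D^{(q)}(r\,|\,X,\rho_{\mathbf D},s)\lesssim\sqrt{\frac{2}{s(1+d)}\,r\log r}\quad(r\to\infty).$$ If additionally $\limsup_{\varepsilon\to0}\frac{\log d^{(q)}(\varepsilon\,|\,Z^{(1)},\|\cdot\|_\infty,s)}{\log(1/\varepsilon)}=d$, then $-\log D^{(q)}(r\,|\,X,\rho_{\mathbf D},s)\sim\sqrt{\frac{2}{s(1+d)}r\log r}$.
   Context: Compound Poisson process: $(e_j)$ i.i.d. standard exponential, $N(t)=\max\{n\ge0:\sum_{j\le n}e_j\le\lambda t\}$, $(Z^{(i)})$ i.i.d. $\mathbb R^d$-valued independent of $(e_j)$ with $\mathbb P(Z^{(1)}=0)=0$, $X(t)=\sum_{i=1}^{N(t)}Z^{(i)}$, $t\in[0,1)$. Distortion on paths: $\rho_{\mathbf D}(f,g)=\int_0^1\|f(t)-g(t)\|_\infty dt$. $D^{(q)}(r\,|\,V,\rho,s)=\inf\{(\mathbb E\min_{a\in\mathcal C}\rho(V,a)^s)^{1/s}:\log\#\mathcal C\le r\}$ (natural log); $d^{(q)}(\varepsilon\,|\,V,\rho,s)=\inf\{n\ge1:D^{(q)}(\log n\,|\,V,\rho,s)\le\varepsilon\}$,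 with $\rho(x,y)=\|x-y\|_\infty$. $f\lesssim g$: $\limsup f/g\le1$; $f\sim g$: $\lim f/g=1$. *)

theory Defs
  imports "HOL-Probability.Probability"
begin

definition epow :: "ennreal \<Rightarrow> real \<Rightarrow> ennreal" where
  "epow x p = (if x = \<top> then \<top> else ennreal (enn2real x powr p))"

definition eln :: "ereal \<Rightarrow> ereal" where
  "eln x = (if x = \<infinity> then \<infinity> else if x \<le> 0 then -\<infinity>
            else ereal (ln (real_of_ereal x)))"

definition quant_err ::
  "'w measure \<Rightarrow> ('w \<Rightarrow> 'b) \<Rightarrow> ('b \<Rightarrow> 'b \<Rightarrow> ennreal) \<Rightarrow> 'b set \<Rightarrow> real \<Rightarrow> real \<Rightarrow> ennreal"
  where
  "quant_err M V \<rho> A s r =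
     (INF C \<in> {C. finite C \<and> C \<noteq> {} \<and> C \<subseteq> A \<and> ln (real (card C)) \<le> r}.
        epow (\<integral>\<^sup>+ \<omega>. epow (INF a \<in> C. \<rho> (V \<omega>) a) s \<partial>M) (1 / s))"

text \<open>Quantization number d^(q)(eps | V, rho, s) = inf {n \<ge> 1 : D^(q)(log n) \<le> eps}
  (infinity if no such n exists).\<close>
definition quant_num ::
  "'w measure \<Rightarrow> ('w \<Rightarrow> 'b) \<Rightarrow> ('b \<Rightarrow> 'b \<Rightarrow> ennreal) \<Rightarrow> 'b set \<Rightarrow> real \<Rightarrow> real \<Rightarrow> ereal"
  where
  "quant_num M V \<rho> A s \<epsilon> =
     Inf {ereal (real n) | n. n \<ge> 1 \<and> quant_err M V \<rho> A s (ln (real n)) \<le> ennreal \<epsilon>}"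

definition dist_inf :: "real^'d \<Rightarrow> real^'d \<Rightarrow> ennreal" where
  "dist_inf x y = ennreal (infnorm (x - y))"

definition rho_D :: "(real \<Rightarrow> real^'d) \<Rightarrow> (real \<Rightarrow> real^'d) \<Rightarrow> ennreal" where
  "rho_D f g = (\<integral>\<^sup>+ t \<in> {0..<1}. ennreal (infnorm (f t - g t)) \<partial>lborel)"

text \<open>Counting process N(t) = max{n : e_1 + ... + e_n \<le> \<lambda> t} (0-based indexing).\<close>
definition count_proc :: "real \<Rightarrow> (nat \<Rightarrow> 'w \<Rightarrow> real) \<Rightarrow> real \<Rightarrow> 'w \<Rightarrow> nat" where
  "count_proc lam e t \<omega> = (GREATEST n. (\<Sum>j<n. e j \<omega>) \<le> lam * t)"

definition cpp :: "real \<Rightarrow> (nat \<Rightarrow> 'w \<Rightarrow> real) \<Rightarrow> (nat \<Rightarrow> 'w \<Rightarrow> real^'d) \<Rightarrow> 'w \<Rightarrow> real \<Rightarrow> real^'d" where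
  "cpp lam e Z \<omega> t = (\<Sum>i < count_proc lam e t \<omega>. Z i \<omega>)"

definition has_nonzero_ac_part :: "(real^'d) measure \<Rightarrow> bool" where
  "has_nonzero_ac_part \<mu> \<longleftrightarrow>
     (\<exists>\<mu>a \<mu>s. sets \<mu>a = sets borel \<and> sets \<mu>s = sets borel \<and>
        (\<forall>B \<in> sets borel. emeasure \<mu> B = emeasure \<mu>a B + emeasure \<mu>s B) \<and>
        absolutely_continuous lborel \<mu>a \<and>
        (\<exists>N \<in> sets borel. emeasure lborel N = 0 \<and> emeasure \<mu>s (UNIV - N) = 0) \<and>
        emeasure \<mu>a UNIV \<noteq> 0)"

end

theory Submission
  imports Defs "HOL-Real_Asymp.Real_Asymp"
begin

text \<open>Write \<open>d\<close> for the dimension. A path with \<open>n\<close> jumps has \<open>n (1 + d)\<close> degrees of freedom, so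
  \<open>exp r\<close> codewords resolve it up to an error of about \<open>exp (- r / (n (1 + d)))\<close>, while \<open>n\<close> jumps
  occur with probability about \<open>exp (- n ln n)\<close>. Hence \<open>D r\<close> is about
  \<open>exp (- min {n ln n / s + r / (n (1 + d)) | n})\<close>, and the minimum is attained near
  \<open>n = sqrt (2 s r / ((1 + d) ln r))\<close>.

  For the lower bound on \<open>D r\<close>, restrict to the event of \<open>n\<close> well separated jumps with values in a
  set where the jump law has a bounded density and stays away from 0. There, two paths that are close
  to the same codeword have close jump times and close jumps, so every ball of radius \<open>\<epsilon>\<close> has
  probability at most \<open>(C n ^ d \<epsilon> ^ (1 + d)) ^ n\<close>. Factors of order \<open>n ^ (C n)\<close> in this estimate are
  harmless, because the root of order \<open>n (1 + d)\<close> is taken afterwards.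

  For the upper bound, use for every \<open>n \<le> r powr (2 / 3)\<close> a product codebook of size about \<open>exp r\<close>,
  with the jump times rounded to a grid and the jumps quantized separately, and the zero path for all
  larger \<open>n\<close>.\<close>

subsection \<open>Paths of the compound Poisson process\<close>

text \<open>The constant in the rate comes from the arithmetic-geometric mean inequality. Near the
  minimum \<open>n\<close> is \<open>sqrt r\<close> up to logarithmic factors, so
  \<open>ln n\<close> is about \<open>ln r / 2\<close> and the exponent is
  \<open>a n + b / n\<close> with \<open>a = ln r / (2 s)\<close> and
  \<open>b = r / (1 + d)\<close>; its minimum is \<open>2 sqrt (a b)\<close>. For the lower bound
  the obstacle is that a codeword is an arbitrary measurable path. A sample path from the same ball
  serves as reference point instead, so that only step paths are compared. For the upper bound the
  obstacle is that the hypothesis on quantization numbers speaks only about accuracies tending to 0,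
  and only up to an exponent \<open>d + \<eta>\<close>. The cutoff exponent 2/3 lies strictly
  between 1/2 and 1. Being below 1, it forces the accuracies for all \<open>n\<close> up to the
  cutoff to 0 uniformly and keeps the factor \<open>2 ^ n\<close> in the codebook size
  subexponential in \<open>r\<close>. Being above 1/2, it lets \<open>n ln n\<close> alone exceed
  the rate for all other \<open>n\<close>.\<close>

lemma borel_measurable_infnorm [measurable]: "infnorm \<in> borel_measurable borel"
  by (intro borel_measurable_continuous_onI continuous_intros)

lemma partial_sum_mono:
  fixes u :: "nat \<Rightarrow> real"
  assumes "\<And>j. 0 \<le> u j" "m \<le> n"
  shows "(\<Sum>j<m. u j) \<le> (\<Sum>j<n. u j)"
  by (rule sum_mono2) (use assms in auto)

text \<open>Nonnegative waiting times make the partial sums monotone, so a single crossing of the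
  level \<open>lam * t\<close> fixes the maximum behind \<open>GREATEST\<close>.\<close>

lemma count_proc_eqI:
  assumes nonneg: "\<And>j. 0 \<le> e j \<omega>"
    and "(\<Sum>j<k. e j \<omega>) \<le> lam * t" "lam * t < (\<Sum>j<Suc k. e j \<omega>)"
  shows "count_proc lam e t \<omega> = k"
  unfolding count_proc_def
proof (rule Greatest_equality)
  fix m assume m: "(\<Sum>j<m. e j \<omega>) \<le> lam * t"
  show "m \<le> k"
  proof (rule ccontr)
    assume "\<not> m \<le> k"
    then have "(\<Sum>j<Suc k. e j \<omega>) \<le> (\<Sum>j<m. e j \<omega>)"
      by (intro partial_sum_mono nonneg) auto
    with m assms(3) show False by linarith
  qed
qed (fact assms(2))

text \<open>A form without \<open>GREATEST\<close>: a fixed number of indicator steps, measurable in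
  \<open>t\<close> and of the same shape as the codewords. The index \<open>n\<close> only has to be
  large enough, since all arrivals after the first \<open>n\<close> come at time 1 or later.\<close>

lemma cpp_eq_sum_jumps:
  fixes Z :: "nat \<Rightarrow> 'w \<Rightarrow> real^'d"
  assumes nonneg: "\<And>j. 0 \<le> e j \<omega>" and lam: "lam > 0"
    and n: "lam \<le> (\<Sum>j<Suc n. e j \<omega>)" and t: "t \<in> {0..<1}"
  shows "cpp lam e Z \<omega> t = (\<Sum>i<n. indicator {(\<Sum>j<Suc i. e j \<omega>) / lam..} t *\<^sub>R Z i \<omega>)"
proof -
  \<comment> \<open>\<open>k\<close> is the number of arrivals up to time \<open>t\<close>; the
    steps with index \<open>k\<close> or more are still switched off.\<close>
  define k where "k = (LEAST k. lam * t < (\<Sum>j<Suc k. e j \<omega>))"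
  have "lam * t < lam" using lam t by simp
  then have ex: "lam * t < (\<Sum>j<Suc n. e j \<omega>)" using n by linarith
  have k: "lam * t < (\<Sum>j<Suc k. e j \<omega>)" "k \<le> n"
    using LeastI[of "\<lambda>k. lam * t < (\<Sum>j<Suc k. e j \<omega>)" n]
      Least_le[of "\<lambda>k. lam * t < (\<Sum>j<Suc k. e j \<omega>)" n] ex by (simp_all add: k_def)
  have kle: "(\<Sum>j<k. e j \<omega>) \<le> lam * t"
  proof (cases k)
    case (Suc m)
    then have "m < (LEAST k. lam * t < (\<Sum>j<Suc k. e j \<omega>))" by (simp add: k_def)
    from not_less_Least[OF this] show ?thesis using Suc by simp
  qed (use lam t in simp)
  have "indicator {(\<Sum>j<Suc i. e j \<omega>) / lam..} t = (if i < k then 1 else 0::real)" for i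
  proof (cases "i < k")
    case True
    then have "(\<Sum>j<Suc i. e j \<omega>) \<le> (\<Sum>j<k. e j \<omega>)"
      by (intro partial_sum_mono nonneg) auto
    with kle have "(\<Sum>j<Suc i. e j \<omega>) \<le> lam * t" by linarith
    with True show ?thesis using lam by (simp add: field_simps)
  next
    case False
    then have "(\<Sum>j<Suc k. e j \<omega>) \<le> (\<Sum>j<Suc i. e j \<omega>)"
      by (intro partial_sum_mono nonneg) auto
    with k have "lam * t < (\<Sum>j<Suc i. e j \<omega>)" by linarith
    with False show ?thesis using lam by (simp add: field_simps)
  qed
  then have "(\<Sum>i<n. indicator {(\<Sum>j<Suc i. e j \<omega>) / lam..} t *\<^sub>R Z i \<omega>)
      = (\<Sum>i<n. if i < k then Z i \<omega> else 0)"
    by (intro sum.cong refl) simp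
  also have "\<dots> = (\<Sum>i<k. Z i \<omega>)"
    using k(2) by (intro sum.mono_neutral_cong_right) auto
  finally show ?thesis
    using count_proc_eqI[of e \<omega> k lam t, OF nonneg kle k(1)] by (simp add: cpp_def)
qed

section \<open>The integral distortion between paths\<close>

lemma rho_D_commute: "rho_D f g = rho_D g f"
  by (simp add: rho_D_def infnorm_sub)

lemma rho_D_triangle:
  fixes f g h :: "real \<Rightarrow> real^'d"
  assumes [measurable]: "f \<in> borel_measurable lborel" "g \<in> borel_measurable lborel" "h \<in> borel_measurable lborel"
  shows "rho_D f h \<le> rho_D f g + rho_D g h"
proof -
  have "rho_D f h \<le> (\<integral>\<^sup>+ t. ennreal (infnorm (f t - g t)) * indicator {0..<1} t
      + ennreal (infnorm (g t - h t)) * indicator {0..<1} t \<partial>lborel)"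
    unfolding rho_D_def
  proof (rule nn_integral_mono)
    fix t
    have "infnorm (f t - h t) \<le> infnorm (f t - g t) + infnorm (g t - h t)"
      using infnorm_triangle[of "f t - g t" "g t - h t"] by simp
    then show "ennreal (infnorm (f t - h t)) * indicator {0..<1} t
      \<le> ennreal (infnorm (f t - g t)) * indicator {0..<1} t
        + ennreal (infnorm (g t - h t)) * indicator {0..<1} t"
      by (auto simp: indicator_def infnorm_pos_le simp flip: ennreal_plus)
  qed
  also have "\<dots> = rho_D f g + rho_D g h"
    unfolding rho_D_def by (rule nn_integral_add) measurable
  finally show ?thesis .
qed

lemma rho_D_cong:
  assumes "\<And>t. t \<in> {0..<1} \<Longrightarrow> f t = f' t"
  shows "rho_D f g = rho_D f' g"
  unfolding rho_D_def by (rule nn_integral_cong) (use assms in \<open>auto simp: indicator_def\<close>)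

lemma rho_D_ge_interval:
  assumes "0 \<le> a" "a \<le> b" "b \<le> 1" "0 \<le> v"
    and "\<And>t. a \<le> t \<Longrightarrow> t < b \<Longrightarrow> v \<le> infnorm (f t - g t)"
  shows "ennreal ((b - a) * v) \<le> rho_D f g"
proof -
  have "ennreal ((b - a) * v) = (\<integral>\<^sup>+ t. ennreal v * indicator {a..<b} t \<partial>lborel)"
    using assms(1-4) by (simp add: nn_integral_cmult_indicator ennreal_mult mult.commute)
  also have "\<dots> \<le> rho_D f g"
    unfolding rho_D_def
    by (rule nn_integral_mono) (use assms in \<open>auto simp: indicator_def intro!: ennreal_leI\<close>)
  finally show ?thesis .
qed

text \<open>A step function is recovered from its path up to a small distance: on the stretch where one
  path has made its next jump and the other has not, the two differ by at least half a jump, so that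
  stretch is short; once both have jumped, they are constant for a time close to \<open>h\<close>, so their
  values are close.\<close>

lemma step_path_stability:
  fixes f f' :: "real \<Rightarrow> real^'d" and z z' :: "nat \<Rightarrow> real^'d"
  assumes \<sigma>: "\<sigma> 0 = 0" "\<And>k. k \<le> n \<Longrightarrow> \<sigma> k + h \<le> \<sigma> (Suc k)" "\<And>k. k \<le> n \<Longrightarrow> \<sigma> k + h \<le> 1"
    and \<sigma>': "\<sigma>' 0 = 0" "\<And>k. k \<le> n \<Longrightarrow> \<sigma>' k + h \<le> \<sigma>' (Suc k)" "\<And>k. k \<le> n \<Longrightarrow> \<sigma>' k + h \<le> 1"
    and f: "\<And>k t. k \<le> n \<Longrightarrow> \<sigma> k \<le> t \<Longrightarrow> t < \<sigma> (Suc k) \<Longrightarrow> f t = (\<Sum>i<k. z i)"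
    and f': "\<And>k t. k \<le> n \<Longrightarrow> \<sigma>' k \<le> t \<Longrightarrow> t < \<sigma>' (Suc k) \<Longrightarrow> f' t = (\<Sum>i<k. z' i)"
    and z: "\<And>k. k < n \<Longrightarrow> \<delta> \<le> infnorm (z k)" and z': "\<And>k. k < n \<Longrightarrow> \<delta> \<le> infnorm (z' k)"
    and \<rho>: "rho_D f f' \<le> ennreal \<eta>" and \<eta>: "0 \<le> \<eta>" "\<eta> \<le> \<delta> * h / 4" and pos: "0 < \<delta>" "0 < h"
    and k: "k \<le> n"
  shows "\<bar>\<sigma> k - \<sigma>' k\<bar> \<le> 2 * \<eta> / \<delta> \<and> infnorm ((\<Sum>i<k. z i) - (\<Sum>i<k. z' i)) \<le> 2 * \<eta> / h"
proof -
  \<comment> \<open>The assumption \<open>\<eta> \<le> \<delta> * h / 4\<close> makes the claimed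
    time error at most half the spacing and the claimed value error at most half the smallest
    jump.\<close>
  have c: "2 * \<eta> / \<delta> \<le> h / 2" "2 * \<eta> / h \<le> \<delta> / 2"
    using \<eta> pos by (simp_all add: field_simps)
  have nonneg: "0 \<le> \<tau> k" if "\<tau> 0 = 0" "\<And>k. k \<le> n \<Longrightarrow> \<tau> k + h \<le> \<tau> (Suc k)" "k \<le> Suc n"
    for k and \<tau> :: "nat \<Rightarrow> real"
    using that(3)
  proof (induction k)
    case (Suc k)
    then show ?case using that(2)[of k] pos by auto
  qed (use that in auto)
  have interval: "(b - a) * v \<le> \<eta>"
    if "0 \<le> a" "a \<le> b" "b \<le> 1" "0 \<le> v" "\<And>t. a \<le> t \<Longrightarrow> t < b \<Longrightarrow> v \<le> infnorm (g t - g' t)"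
      "rho_D g g' \<le> ennreal \<eta>" for a b v and g g' :: "real \<Rightarrow> real^'d"
  proof -
    have "ennreal ((b - a) * v) \<le> ennreal \<eta>"
      using rho_D_ge_interval[of a b v g g'] that by (meson order_trans)
    then show ?thesis using \<eta> by (simp add: ennreal_le_iff)
  qed
  \<comment> \<open>Stated for arbitrary pairs of paths because it is applied twice with the roles
    exchanged, which bounds the absolute value.\<close>
  have jump: "\<tau>' (Suc k) - \<tau> (Suc k) \<le> 2 * \<eta> / \<delta>"
    if \<tau>: "\<tau> 0 = 0" "\<And>k. k \<le> n \<Longrightarrow> \<tau> k + h \<le> \<tau> (Suc k)" "\<And>k. k \<le> n \<Longrightarrow> \<tau> k + h \<le> 1"
      and g: "\<And>k t. k \<le> n \<Longrightarrow> \<tau> k \<le> t \<Longrightarrow> t < \<tau> (Suc k) \<Longrightarrow> g t = (\<Sum>i<k. y i)"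
      and g': "\<And>k t. k \<le> n \<Longrightarrow> \<tau>' k \<le> t \<Longrightarrow> t < \<tau>' (Suc k) \<Longrightarrow> g' t = (\<Sum>i<k. y' i)"
      and y: "\<And>k. k < n \<Longrightarrow> \<delta> \<le> infnorm (y k)" and \<rho>': "rho_D g g' \<le> ennreal \<eta>"
      and k: "Suc k \<le> n" and IH: "\<bar>\<tau> k - \<tau>' k\<bar> \<le> 2 * \<eta> / \<delta>"
        "infnorm ((\<Sum>i<k. y i) - (\<Sum>i<k. y' i)) \<le> 2 * \<eta> / h"
    for \<tau> \<tau>' :: "nat \<Rightarrow> real" and g g' :: "real \<Rightarrow> real^'d" and y y' k
  proof (rule ccontr)
    assume "\<not> ?thesis"
    then have gt: "\<tau> (Suc k) + 2 * \<eta> / \<delta> < \<tau>' (Suc k)" by simp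
    \<comment> \<open>The cap at \<open>\<tau> (Suc k) + h\<close> ensures that between
      \<open>\<tau> (Suc k)\<close> and \<open>b\<close> the path \<open>g\<close> has made the jump
      \<open>y k\<close> but not the next one, while \<open>g'\<close> has not yet made
      \<open>y' k\<close>.\<close>
    define b where "b = min (\<tau>' (Suc k)) (\<tau> (Suc k) + h)"
    have nn: "0 \<le> 2 * \<eta> / \<delta>" using \<eta> pos by simp
    have b: "\<tau> (Suc k) + 2 * \<eta> / \<delta> < b" "b \<le> \<tau>' (Suc k)" "b \<le> \<tau> (Suc k) + h"
      using gt c pos by (auto simp: b_def)
    have "(b - \<tau> (Suc k)) * (\<delta> / 2) \<le> \<eta>"
    proof (rule interval[where g=g and g'=g'])
      show "0 \<le> \<tau> (Suc k)" by (rule nonneg[of \<tau>]) (use \<tau> k in auto)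
      show "\<tau> (Suc k) \<le> b" using b nn by simp
      show "b \<le> 1" using b \<tau>(3)[of "Suc k"] k by simp
      fix t assume t: "\<tau> (Suc k) \<le> t" "t < b"
      have 1: "g t = (\<Sum>i<Suc k. y i)"
        using t b \<tau>(2)[of "Suc k"] k by (intro g) auto
      have "\<tau>' k \<le> \<tau> k + h" using IH(1) c pos by linarith
      then have 2: "g' t = (\<Sum>i<k. y' i)"
        using t b \<tau>(2)[of k] k by (intro g') auto
      have "\<delta> \<le> infnorm (y k)" using y k by simp
      also have "y k = (g t - g' t) + ((\<Sum>i<k. y' i) - (\<Sum>i<k. y i))"
        by (simp add: 1 2)
      also have "infnorm \<dots> \<le> infnorm (g t - g' t) + infnorm ((\<Sum>i<k. y' i) - (\<Sum>i<k. y i))"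
        by (rule infnorm_triangle)
      also have "infnorm ((\<Sum>i<k. y' i) - (\<Sum>i<k. y i)) \<le> \<delta> / 2"
        using IH(2) c by (simp add: infnorm_sub)
      finally show "\<delta> / 2 \<le> infnorm (g t - g' t)" by simp
    qed (use pos \<rho>' in auto)
    moreover have "2 * \<eta> / \<delta> * (\<delta> / 2) < (b - \<tau> (Suc k)) * (\<delta> / 2)"
      using b pos by (intro mult_strict_right_mono) auto
    ultimately show False using pos by simp
  qed
  \<comment> \<open>The errors do not accumulate: the induction hypothesis controls jump times and
    partial sums rather than increments, and every step derives the same bounds afresh from the
    distortion.\<close>
  show ?thesis using k
  proof (induction k)
    case 0
    then show ?case using \<sigma> \<sigma>' \<eta> pos by (simp add: infnorm_0)
  next
    case (Suc k)
    then have IH: "\<bar>\<sigma> k - \<sigma>' k\<bar> \<le> 2 * \<eta> / \<delta>"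
      "infnorm ((\<Sum>i<k. z i) - (\<Sum>i<k. z' i)) \<le> 2 * \<eta> / h" by auto
    have "\<sigma>' (Suc k) - \<sigma> (Suc k) \<le> 2 * \<eta> / \<delta>"
      by (rule jump[of \<sigma> f z \<sigma>' f' z']) (use \<sigma> f f' z \<rho> Suc.prems IH in auto)
    moreover have "\<sigma> (Suc k) - \<sigma>' (Suc k) \<le> 2 * \<eta> / \<delta>"
      by (rule jump[of \<sigma>' f' z' \<sigma> f z])
        (use \<sigma>' f f' z' \<rho> Suc.prems IH in \<open>auto simp: rho_D_commute infnorm_sub abs_minus_commute\<close>)
    ultimately have close: "\<bar>\<sigma> (Suc k) - \<sigma>' (Suc k)\<bar> \<le> 2 * \<eta> / \<delta>" by simp
    \<comment> \<open>From \<open>a\<close> on both paths have made the jump, and since the jump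
      times are close, neither makes another before \<open>a + h / 2\<close>.\<close>
    define a where "a = max (\<sigma> (Suc k)) (\<sigma>' (Suc k))"
    let ?v = "infnorm ((\<Sum>i<Suc k. z i) - (\<Sum>i<Suc k. z' i))"
    have a: "a + h / 2 \<le> \<sigma> (Suc k) + h" "a + h / 2 \<le> \<sigma>' (Suc k) + h"
      using close c by (auto simp: a_def)
    have "(a + h / 2 - a) * ?v \<le> \<eta>"
    proof (rule interval[where g=f and g'=f'])
      show "0 \<le> a" unfolding a_def using nonneg[of \<sigma> "Suc k"] \<sigma> Suc.prems by (simp add: max.coboundedI1)
      show "a + h / 2 \<le> 1" using a \<sigma>(3)[of "Suc k"] Suc.prems by simp
      fix t assume t: "a \<le> t" "t < a + h / 2"
      have "f t = (\<Sum>i<Suc k. z i)"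
        using t a \<sigma>(2)[of "Suc k"] Suc.prems by (intro f) (auto simp: a_def)
      moreover have "f' t = (\<Sum>i<Suc k. z' i)"
        using t a \<sigma>'(2)[of "Suc k"] Suc.prems by (intro f') (auto simp: a_def)
      ultimately show "?v \<le> infnorm (f t - f' t)" by simp
    qed (use pos \<rho> in \<open>auto simp: infnorm_pos_le\<close>)
    then have "?v \<le> 2 * \<eta> / h" using pos by (simp add: field_simps)
    with close show ?case by blast
  qed
qed

lemma nn_integral_indicator_diff_le:
  fixes a b :: real
  shows "(\<integral>\<^sup>+ t. ennreal \<bar>indicator {a..} t - indicator {b..} t\<bar> \<partial>lborel) \<le> ennreal \<bar>a - b\<bar>"
proof -
  have "(\<integral>\<^sup>+ t. ennreal \<bar>indicator {a..} t - indicator {b..} t\<bar> \<partial>lborel)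
     \<le> (\<integral>\<^sup>+ t. indicator {min a b..max a b} t \<partial>lborel)"
    by (rule nn_integral_mono) (auto simp: indicator_def)
  also have "\<dots> = ennreal \<bar>a - b\<bar>"
    by (simp add: max_def min_def abs_if)
  finally show ?thesis .
qed

text \<open>With \<open>i\<close> and \<open>j\<close> the two indicators, the splitting
  \<open>(i - j) z + j (z - z')\<close> charges a displacement only to the jump size of the first
  path. The times may be unordered or coincide, as rounded times do.\<close>

lemma rho_D_step_paths_le:
  fixes z z' :: "nat \<Rightarrow> real^'d"
  shows "rho_D (\<lambda>t. \<Sum>i<n. indicator {\<tau> i..} t *\<^sub>R z i) (\<lambda>t. \<Sum>i<n. indicator {\<tau>' i..} t *\<^sub>R z' i)
    \<le> ennreal (\<Sum>i<n. infnorm (z i - z' i) + \<bar>\<tau> i - \<tau>' i\<bar> * infnorm (z i))"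
proof -
  have "infnorm ((\<Sum>i<n. indicator {\<tau> i..} t *\<^sub>R z i) - (\<Sum>i<n. indicator {\<tau>' i..} t *\<^sub>R z' i))
    \<le> (\<Sum>i<n. infnorm (z i - z' i) + \<bar>indicator {\<tau> i..} t - indicator {\<tau>' i..} t\<bar> * infnorm (z i))" for t
  proof (induction n)
    case (Suc n)
    let ?i = "indicator {\<tau> n..} t :: real" and ?j = "indicator {\<tau>' n..} t :: real"
    have "infnorm (?i *\<^sub>R z n - ?j *\<^sub>R z' n) = infnorm ((?i - ?j) *\<^sub>R z n + ?j *\<^sub>R (z n - z' n))"
      by (simp add: algebra_simps)
    also have "\<dots> \<le> \<bar>?i - ?j\<bar> * infnorm (z n) + \<bar>?j\<bar> * infnorm (z n - z' n)"
      using infnorm_triangle[of "(?i - ?j) *\<^sub>R z n" "?j *\<^sub>R (z n - z' n)"] by (simp only: infnorm_mul)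
    also have "\<bar>?j\<bar> * infnorm (z n - z' n) \<le> infnorm (z n - z' n)"
      by (auto simp: indicator_def infnorm_pos_le)
    finally have *: "infnorm (?i *\<^sub>R z n - ?j *\<^sub>R z' n) \<le> infnorm (z n - z' n) + \<bar>?i - ?j\<bar> * infnorm (z n)"
      by simp
    let ?A = "(\<Sum>i<n. indicator {\<tau> i..} t *\<^sub>R z i) - (\<Sum>i<n. indicator {\<tau>' i..} t *\<^sub>R z' i)"
    have "infnorm (?A + (?i *\<^sub>R z n - ?j *\<^sub>R z' n)) \<le> infnorm ?A + infnorm (?i *\<^sub>R z n - ?j *\<^sub>R z' n)"
      by (rule infnorm_triangle)
    with * Suc.IH show ?case by (simp add: algebra_simps)
  qed (simp add: infnorm_0)
  then have "rho_D (\<lambda>t. \<Sum>i<n. indicator {\<tau> i..} t *\<^sub>R z i) (\<lambda>t. \<Sum>i<n. indicator {\<tau>' i..} t *\<^sub>R z' i)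
    \<le> (\<integral>\<^sup>+ t. (\<Sum>i<n. ennreal (infnorm (z i - z' i)) * indicator {0..<1} t
      + ennreal \<bar>indicator {\<tau> i..} t - indicator {\<tau>' i..} t\<bar> * ennreal (infnorm (z i))) \<partial>lborel)"
    (is "_ \<le> ?I")
    unfolding rho_D_def
    by (intro nn_integral_mono)
      (auto simp: indicator_def infnorm_pos_le sum_nonneg
         simp flip: ennreal_mult ennreal_plus intro!: ennreal_leI)
  also have "?I = (\<Sum>i<n. (\<integral>\<^sup>+ t. ennreal (infnorm (z i - z' i)) * indicator {0..<1::real} t \<partial>lborel)
      + (\<integral>\<^sup>+ t. ennreal \<bar>indicator {\<tau> i..} t - indicator {\<tau>' i..} t\<bar> * ennreal (infnorm (z i)) \<partial>lborel))"
    by (subst nn_integral_sum) (auto intro!: sum.cong nn_integral_add)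
  also have "\<dots> \<le> (\<Sum>i<n. ennreal (infnorm (z i - z' i)) + ennreal \<bar>\<tau> i - \<tau>' i\<bar> * ennreal (infnorm (z i)))"
    by (intro sum_mono add_mono)
      (auto simp: nn_integral_cmult_indicator nn_integral_multc intro!: mult_right_mono nn_integral_indicator_diff_le)
  also have "\<dots> = ennreal (\<Sum>i<n. infnorm (z i - z' i) + \<bar>\<tau> i - \<tau>' i\<bar> * infnorm (z i))"
    by (simp add: infnorm_pos_le ennreal_mult sum_nonneg flip: sum_ennreal)
  finally show ?thesis .
qed

subsection \<open>Probability estimates\<close>

lemma emeasure_lborel_infnorm_cball_le:
  fixes z :: "real^'d"
  assumes "0 \<le> r"
  shows "emeasure lborel {x. infnorm (x - z) \<le> r} \<le> ennreal ((2 * r) ^ CARD('d))"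
proof -
  let ?v = "\<chi> i. r :: real^'d"
  have "{x. infnorm (x - z) \<le> r} \<subseteq> cbox (z - ?v) (z + ?v)"
  proof (safe, unfold mem_box_cart, intro allI)
    fix x i assume "infnorm (x - z) \<le> r"
    then have "\<bar>(x - z) $ i\<bar> \<le> r" using component_le_infnorm_cart[of "x - z" i] by linarith
    then show "(z - ?v) $ i \<le> x $ i \<and> x $ i \<le> (z + ?v) $ i" by auto
  qed
  then have "emeasure lborel {x. infnorm (x - z) \<le> r} \<le> emeasure lborel (cbox (z - ?v) (z + ?v))"
    by (intro emeasure_mono) auto
  also have "\<dots> = ennreal (\<Prod>b\<in>Basis. ((z + ?v) - (z - ?v)) \<bullet> b)"
    using assms by (intro emeasure_lborel_cbox) (auto simp: Basis_vec_def inner_axis)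
  also have "(\<Prod>b\<in>Basis. ((z + ?v) - (z - ?v)) \<bullet> b) = (\<Prod>b\<in>(Basis::(real^'d) set). 2 * r)"
    by (intro prod.cong) (auto simp: Basis_vec_def inner_axis)
  finally show ?thesis by simp
qed

text \<open>\<open>B\<close> is cut out by bounding the density \<open>f\<close> of the absolutely
  continuous part, staying away from 0, and discarding the null set \<open>N\<close> that carries
  the singular part. On such a set \<open>\<mu>\<close> itself has a bounded density.\<close>

lemma has_nonzero_ac_partE:
  fixes \<mu> :: "(real^'d) measure"
  assumes ac: "has_nonzero_ac_part \<mu>" and fin: "finite_measure \<mu>" and sets: "sets \<mu> = sets borel"
  obtains B \<delta> K where "B \<in> sets borel" "0 < \<delta>" "0 < K" "\<And>z. z \<in> B \<Longrightarrow> \<delta> \<le> infnorm z"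
    "emeasure \<mu> B > 0" "\<And>A. A \<in> sets borel \<Longrightarrow> emeasure \<mu> (A \<inter> B) \<le> ennreal K * emeasure lborel A"
proof -
  interpret finite_measure \<mu> by fact
  from ac obtain \<mu>a \<mu>s N where S: "sets \<mu>a = sets borel" "sets \<mu>s = sets borel"
    and sum: "\<And>B. B \<in> sets borel \<Longrightarrow> emeasure \<mu> B = emeasure \<mu>a B + emeasure \<mu>s B"
    and abs: "absolutely_continuous lborel \<mu>a"
    and N: "N \<in> sets borel" "emeasure lborel N = 0" "emeasure \<mu>s (UNIV - N) = 0"
    and nz: "emeasure \<mu>a UNIV \<noteq> 0"
    unfolding has_nonzero_ac_part_def by blast
  have "\<exists>f\<in>borel_measurable lborel. density lborel f = \<mu>a"
    by (rule sigma_finite_measure.Radon_Nikodym) (use abs S in \<open>auto intro: sigma_finite_lborel\<close>)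
  then obtain f where f[measurable]: "f \<in> borel_measurable borel" and dens: "density lborel f = \<mu>a"
    by (auto simp: measurable_lborel1)
  have f_fin: "AE x in lborel. f x \<noteq> \<infinity>"
  proof (rule nn_integral_PInf_AE)
    have "(\<integral>\<^sup>+ x. f x \<partial>lborel) = emeasure \<mu>a UNIV"
      by (simp add: emeasure_density flip: dens)
    also have "\<dots> \<le> emeasure \<mu> UNIV" using sum[of UNIV] by simp
    also have "\<dots> < \<infinity>" using emeasure_finite[of UNIV] by (simp add: less_top[symmetric])
    finally show "integral\<^sup>N lborel f \<noteq> \<infinity>" by simp
  qed simp
  define B where "B k = {x. f x \<le> ennreal (real (Suc k)) \<and> 1 / real (Suc k) \<le> infnorm x} - N" for k
  have Bm[measurable]: "B k \<in> sets borel" for k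
    unfolding B_def using N(1) by measurable
  \<comment> \<open>Since \<open>f\<close> is finite almost everywhere, the sets \<open>B k\<close>
    cover almost every point; if all of them were null for \<open>\<mu>a\<close>, so would be the
    whole space.\<close>
  have "\<exists>k. emeasure \<mu>a (B k) > 0"
  proof (rule ccontr)
    assume "\<not> ?thesis"
    then have "B k \<in> null_sets \<mu>a" for k by (auto simp: null_sets_def S)
    then have "(\<Union>k. B k) \<in> null_sets \<mu>a" by (rule null_sets_UN)
    then have 1: "AE x in \<mu>a. x \<notin> (\<Union>k. B k)" by (rule AE_not_in)
    have "N \<in> null_sets lborel" using N by (auto simp: null_sets_def)
    then have "AE x in lborel. x \<notin> N" by (rule AE_not_in)
    moreover have "AE x in lborel. x \<noteq> 0" by (rule AE_lborel_singleton)
    ultimately have "AE x in lborel. x \<in> (\<Union>k. B k)"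
      using f_fin
    proof eventually_elim
      case (elim x)
      obtain c where c: "f x = ennreal c" "0 \<le> c"
        using elim by (cases "f x") auto
      obtain k :: nat where k: "max c (1 / infnorm x) \<le> real k" using real_arch_simple by blast
      have ip: "infnorm x > 0" using elim by (simp add: infnorm_pos_lt)
      have "1 \<le> real (Suc k) * infnorm x"
      proof -
        have "1 = (1 / infnorm x) * infnorm x" using ip by simp
        also have "\<dots> \<le> real (Suc k) * infnorm x" using k ip by (intro mult_right_mono) auto
        finally show ?thesis .
      qed
      then have "1 / real (Suc k) \<le> infnorm x" by (simp add: field_simps)
      moreover have "f x \<le> ennreal (real (Suc k))" unfolding c(1) by (rule ennreal_leI) (use k in simp)
      ultimately have "x \<in> B k" using elim by (auto simp: B_def)
      then show ?case by blast
    qed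
    then have "AE x in \<mu>a. x \<in> (\<Union>k. B k)"
      using abs S by (intro absolutely_continuous_AE[OF _ abs]) (auto simp: )
    with 1 have "AE x in \<mu>a. False" by eventually_elim auto
    then have "emeasure \<mu>a (space \<mu>a) = 0"
      by (simp add: AE_iff_null null_sets_def)
    moreover have "space \<mu>a = UNIV" using sets_eq_imp_space_eq[OF S(1)] by simp
    ultimately show False using nz by simp
  qed
  then obtain k where k: "emeasure \<mu>a (B k) > 0" ..
  show ?thesis
  proof (rule that[of "B k" "1 / real (Suc k)" "real (Suc k)"])
    show "B k \<in> sets borel" by (rule Bm)
    show "emeasure \<mu> (B k) > 0" using k sum[of "B k"] by (simp add: add_pos_nonneg)
    fix A :: "(real^'d) set" assume A: "A \<in> sets borel"
    have "emeasure \<mu>s (A \<inter> B k) \<le> emeasure \<mu>s (UNIV - N)"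
      using N by (intro emeasure_mono) (auto simp: B_def S)
    then have "emeasure \<mu> (A \<inter> B k) = emeasure \<mu>a (A \<inter> B k)"
      using sum[of "A \<inter> B k"] A N by simp
    also have "\<dots> = (\<integral>\<^sup>+ x. f x * indicator (A \<inter> B k) x \<partial>lborel)"
      using A by (simp add: emeasure_density flip: dens)
    also have "\<dots> \<le> (\<integral>\<^sup>+ x. ennreal (real (Suc k)) * indicator A x \<partial>lborel)"
      by (rule nn_integral_mono) (auto simp: B_def indicator_def)
    also have "\<dots> = ennreal (real (Suc k)) * emeasure lborel A"
      using A by (simp add: nn_integral_cmult_indicator)
    finally show "emeasure \<mu> (A \<inter> B k) \<le> ennreal (real (Suc k)) * emeasure lborel A" .
  qed (auto simp: B_def)
qed

section \<open>Waiting times, jumps and their independence\<close>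

locale compound_poisson = prob_space M for M :: "'w measure" +
  fixes lam :: real and e :: "nat \<Rightarrow> 'w \<Rightarrow> real" and Z :: "nat \<Rightarrow> 'w \<Rightarrow> real^'d"
  assumes lam_pos: "lam > 0"
    and distributed_e: "\<And>j. distributed M lborel (e j) (\<lambda>x. ennreal (exponential_density 1 x))"
    and indep_e: "indep_vars (\<lambda>_. borel) e UNIV"
    and measurable_Z [measurable]: "\<And>i. Z i \<in> borel_measurable M"
    and distr_Z: "\<And>i. distr M borel (Z i) = distr M borel (Z 0)"
    and indep_Z: "indep_vars (\<lambda>_. borel) Z UNIV"
    and indep_e_Z: "indep_set
           (sets (vimage_algebra (space M) (\<lambda>\<omega> j. e j \<omega>) (PiM UNIV (\<lambda>_. borel))))
           (sets (vimage_algebra (space M) (\<lambda>\<omega> i. Z i \<omega>) (PiM UNIV (\<lambda>_. borel))))"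
begin

lemma measurable_e [measurable]: "e j \<in> borel_measurable M"
  using distributed_measurable[OF distributed_e] by simp

lemma prob_e_and_Z:
  assumes P: "Measurable.pred (PiM UNIV (\<lambda>_. borel)) P" and Q: "Measurable.pred (PiM UNIV (\<lambda>_. borel)) Q"
  shows "prob {\<omega> \<in> space M. P (\<lambda>j. e j \<omega>) \<and> Q (\<lambda>i. Z i \<omega>)}
    = prob {\<omega> \<in> space M. P (\<lambda>j. e j \<omega>)} * prob {\<omega> \<in> space M. Q (\<lambda>i. Z i \<omega>)}"
proof -
  have "{x. P x} \<in> sets (PiM UNIV (\<lambda>_. borel))" "{x. Q x} \<in> sets (PiM UNIV (\<lambda>_. borel))"
    using P Q by (simp_all add: pred_def space_PiM)
  then have "(\<lambda>\<omega> j. e j \<omega>) -` {x. P x} \<inter> space M \<in> sets (vimage_algebra (space M) (\<lambda>\<omega> j. e j \<omega>) (PiM UNIV (\<lambda>_. borel)))"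
    "(\<lambda>\<omega> i. Z i \<omega>) -` {x. Q x} \<inter> space M \<in> sets (vimage_algebra (space M) (\<lambda>\<omega> i. Z i \<omega>) (PiM UNIV (\<lambda>_. borel)))"
    using in_vimage_algebra[of "{x. P x}" "PiM UNIV (\<lambda>_. borel)" "\<lambda>\<omega> j. e j \<omega>" "space M"]
      in_vimage_algebra[of "{x. Q x}" "PiM UNIV (\<lambda>_. borel)" "\<lambda>\<omega> i. Z i \<omega>" "space M"] by auto
  from indep_setD[OF indep_e_Z this] show ?thesis
    by (simp add: vimage_def Collect_conj_eq[symmetric] Int_def conj_ac)
qed

lemma prob_Ball_eq_prod:
  fixes X :: "nat \<Rightarrow> 'w \<Rightarrow> 'c::topological_space"
  assumes X: "indep_vars (\<lambda>_. borel) X UNIV" and A: "\<And>i. A i \<in> sets borel"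
  shows "prob {\<omega> \<in> space M. \<forall>i<n. X i \<omega> \<in> A i} = (\<Prod>i<n. prob {\<omega> \<in> space M. X i \<omega> \<in> A i})"
proof (cases "n = 0")
  case False
  have "prob (\<Inter>i\<in>{..<n}. X i -` A i \<inter> space M) = (\<Prod>i<n. prob (X i -` A i \<inter> space M))"
    by (rule indep_varsD[OF X]) (use A False in auto)
  moreover have "(\<Inter>i\<in>{..<n}. X i -` A i \<inter> space M) = {\<omega> \<in> space M. \<forall>i<n. X i \<omega> \<in> A i}"
    using False by auto
  ultimately show ?thesis by (simp add: vimage_def Int_def conj_ac)
qed (simp add: prob_space)

lemma prob_Z_eq: "A \<in> sets borel \<Longrightarrow> prob {\<omega> \<in> space M. Z i \<omega> \<in> A} = measure (distr M borel (Z 0)) A"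
  by (subst distr_Z[of i, symmetric]) (simp add: measure_distr vimage_def Int_def conj_ac)

lemma nn_integral_Z_eq:
  assumes [measurable]: "\<phi> \<in> borel_measurable borel"
  shows "(\<integral>\<^sup>+ \<omega>. \<phi> (Z i \<omega>) \<partial>M) = (\<integral>\<^sup>+ \<omega>. \<phi> (Z 0 \<omega>) \<partial>M)"
proof -
  have "(\<integral>\<^sup>+ \<omega>. \<phi> (Z i \<omega>) \<partial>M) = (\<integral>\<^sup>+ x. \<phi> x \<partial>distr M borel (Z i))"
    by (simp add: nn_integral_distr)
  also have "\<dots> = (\<integral>\<^sup>+ \<omega>. \<phi> (Z 0 \<omega>) \<partial>M)"
    by (subst distr_Z) (simp add: nn_integral_distr)
  finally show ?thesis .
qed

text \<open>By independence, restricting \<open>M\<close> to an event of the waiting times and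
  pushing it forward by \<open>Z i\<close> only rescales the jump law. Integrating against this
  identity of measures gives the product formula for all \<open>\<phi>\<close> at once.\<close>

lemma nn_integral_indicator_mult_Z:
  assumes P: "Measurable.pred (PiM UNIV (\<lambda>_. borel)) P" and [measurable]: "\<phi> \<in> borel_measurable borel"
    and A: "A = {\<omega> \<in> space M. P (\<lambda>j. e j \<omega>)}"
  shows "(\<integral>\<^sup>+ \<omega>. indicator A \<omega> * \<phi> (Z i \<omega>) \<partial>M) = emeasure M A * (\<integral>\<^sup>+ \<omega>. \<phi> (Z 0 \<omega>) \<partial>M)"
proof -
  have "(\<lambda>\<omega> j. e j \<omega>) \<in> measurable M (PiM UNIV (\<lambda>_. borel))"
    by (rule measurable_PiM_single') auto
  then have "Measurable.pred M (\<lambda>\<omega>. P (\<lambda>j. e j \<omega>))" by (rule measurable_compose[OF _ P])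
  then have A_sets [measurable]: "A \<in> sets M" unfolding A by (simp only: pred_def)
  have eq: "distr (density M (indicator A)) borel (Z i) = scale_measure (emeasure M A) (distr M borel (Z i))"
  proof (rule measure_eqI)
    fix B assume "B \<in> sets (distr (density M (indicator A)) borel (Z i))"
    then have B[measurable]: "B \<in> sets borel" by simp
    have "emeasure (distr (density M (indicator A)) borel (Z i)) B
        = emeasure M (A \<inter> (Z i -` B \<inter> space M))"
      using emeasure_density[of "indicator A" M "Z i -` B \<inter> space M"] A_sets
      by (simp add: emeasure_distr indicator_inter_arith[symmetric])
    also have "A \<inter> (Z i -` B \<inter> space M) = {\<omega> \<in> space M. P (\<lambda>j. e j \<omega>) \<and> Z i \<omega> \<in> B}"
      by (auto simp: A)
    also have "emeasure M \<dots> = ennreal (prob {\<omega> \<in> space M. P (\<lambda>j. e j \<omega>)} * prob {\<omega> \<in> space M. Z i \<omega> \<in> B})"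
      using prob_e_and_Z[OF P, of "\<lambda>x. x i \<in> B"] by (simp add: emeasure_eq_measure)
    also have "\<dots> = emeasure M A * emeasure M (Z i -` B \<inter> space M)"
      unfolding A emeasure_eq_measure vimage_def Int_def
      by (simp add: ennreal_mult conj_commute)
    finally show "emeasure (distr (density M (indicator A)) borel (Z i)) B
        = emeasure (scale_measure (emeasure M A) (distr M borel (Z i))) B"
      by (simp add: emeasure_distr)
  qed simp
  have "(\<integral>\<^sup>+ \<omega>. indicator A \<omega> * \<phi> (Z i \<omega>) \<partial>M) = (\<integral>\<^sup>+ x. \<phi> x \<partial>distr (density M (indicator A)) borel (Z i))"
    by (simp add: nn_integral_distr nn_integral_density)
  also have "\<dots> = emeasure M A * (\<integral>\<^sup>+ \<omega>. \<phi> (Z i \<omega>) \<partial>M)"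
    unfolding eq by (simp add: nn_integral_scale_measure nn_integral_distr)
  finally show ?thesis by (simp add: nn_integral_Z_eq[of \<phi> i])
qed

lemma emeasure_e: "A \<in> sets borel \<Longrightarrow>
    emeasure M {\<omega> \<in> space M. e j \<omega> \<in> A} = (\<integral>\<^sup>+ x. ennreal (exponential_density 1 x) * indicator A x \<partial>lborel)"
  using distributed_emeasure[OF distributed_e, of A j] by (simp add: vimage_def Int_def conj_ac)

lemma AE_e_nonneg: "AE \<omega> in M. \<forall>j. 0 \<le> e j \<omega>"
proof (subst AE_all_countable, rule allI)
  fix j
  have "emeasure M {\<omega> \<in> space M. e j \<omega> \<in> {..<0}} = 0"
    by (subst emeasure_e) (auto simp: nn_integral_0_iff_AE exponential_density_def indicator_def)
  then show "AE \<omega> in M. 0 \<le> e j \<omega>"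
    by (subst AE_iff_measurable[OF _ refl]) (auto simp: not_le)
qed

lemma prob_e_interval_le:
  assumes "a \<le> b"
  shows "prob {\<omega> \<in> space M. e j \<omega> \<in> {a..b}} \<le> b - a"
proof -
  have "emeasure M {\<omega> \<in> space M. e j \<omega> \<in> {a..b}} \<le> (\<integral>\<^sup>+ x. indicator {a..b} x \<partial>lborel)"
    by (subst emeasure_e, simp, intro nn_integral_mono)
      (auto simp: exponential_density_def indicator_def)
  then show ?thesis using assms by (simp add: emeasure_eq_measure)
qed

lemma prob_e_interval_ge:
  assumes "0 \<le> a" "a \<le> b" "b \<le> lam"
  shows "(b - a) * exp (- lam) \<le> prob {\<omega> \<in> space M. e j \<omega> \<in> {a..b}}"
proof -
  have "ennreal ((b - a) * exp (- lam)) = (\<integral>\<^sup>+ x. ennreal (exp (- lam)) * indicator {a..b} x \<partial>lborel)"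
    using assms by (simp add: nn_integral_cmult_indicator ennreal_mult mult.commute)
  also have "\<dots> \<le> emeasure M {\<omega> \<in> space M. e j \<omega> \<in> {a..b}}"
    using assms by (subst emeasure_e)
      (auto simp: exponential_density_def indicator_def intro!: nn_integral_mono)
  finally show ?thesis by (simp add: emeasure_eq_measure)
qed

lemma prob_e_ge_lam: "exp (- lam) \<le> prob {\<omega> \<in> space M. e j \<omega> \<in> {lam..}}"
proof -
  have "exp (- lam) = prob {\<omega> \<in> space M. lam < e j \<omega>}"
    using exponential_distributedD_gt[OF distributed_e, of lam] lam_pos by simp
  also have "\<dots> \<le> prob {\<omega> \<in> space M. e j \<omega> \<in> {lam..}}"
    by (rule finite_measure_mono) auto
  finally show ?thesis .
qed

text \<open>Multiplying the density by \<open>exp (- \<theta> * x)\<close> gives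
  \<open>1 / (1 + \<theta>)\<close> times the exponential density of rate
  \<open>1 + \<theta>\<close>, which integrates to 1.\<close>

lemma nn_integral_exp_e:
  assumes "0 \<le> \<theta>"
  shows "(\<integral>\<^sup>+ \<omega>. ennreal (exp (- \<theta> * e j \<omega>)) \<partial>M) = ennreal (1 / (1 + \<theta>))"
proof -
  have "(\<integral>\<^sup>+ \<omega>. ennreal (exp (- \<theta> * e j \<omega>)) \<partial>M)
      = (\<integral>\<^sup>+ x. ennreal (exponential_density 1 x) * ennreal (exp (- \<theta> * x)) \<partial>lborel)"
    by (rule distributed_nn_integral[OF distributed_e, symmetric]) simp
  also have "\<dots> = (\<integral>\<^sup>+ x. ennreal (1 / (1 + \<theta>)) * ennreal (exponential_density (1 + \<theta>) x) \<partial>lborel)"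
  proof (rule nn_integral_cong)
    fix x :: real
    have "exponential_density 1 x * exp (- \<theta> * x) = 1 / (1 + \<theta>) * exponential_density (1 + \<theta>) x"
    proof (cases "x < 0")
      case False
      have "exp (- x) * exp (- \<theta> * x) = exp (- x * (1 + \<theta>))"
        by (simp add: algebra_simps flip: exp_add)
      then show ?thesis using assms False by (simp add: exponential_density_def)
    qed (simp add: exponential_density_def)
    then show "ennreal (exponential_density 1 x) * ennreal (exp (- \<theta> * x))
        = ennreal (1 / (1 + \<theta>)) * ennreal (exponential_density (1 + \<theta>) x)"
      using assms exponential_density_nonneg[of 1 x] exponential_density_nonneg[of "1 + \<theta>" x]
        ennreal_mult[of "exponential_density 1 x" "exp (- \<theta> * x)"]
        ennreal_mult[of "1 / (1 + \<theta>)" "exponential_density (1 + \<theta>) x"]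
      by auto
  qed
  also have "\<dots> = ennreal (1 / (1 + \<theta>)) * (\<integral>\<^sup>+ x. ennreal (exponential_density (1 + \<theta>) x) \<partial>lborel)"
    by (simp add: nn_integral_cmult)
  also have "(\<integral>\<^sup>+ x. ennreal (exponential_density (1 + \<theta>) x) \<partial>lborel) = 1"
    using prob_space.emeasure_space_1[OF prob_space_exponential_density, of "1 + \<theta>"] assms
    by (simp add: emeasure_density)
  finally show ?thesis by simp
qed

text \<open>Chernoff bound for having at least \<open>n\<close> arrivals by time 1. It supplies the
  cost \<open>n ln n\<close>, up to a factor \<open>C ^ n\<close>, in the upper bound for the
  quantization error.\<close>

lemma prob_sum_e_le:
  assumes "n \<ge> 1"
  shows "prob {\<omega> \<in> space M. (\<Sum>j<n. e j \<omega>) \<le> lam} \<le> (exp 1 * lam / n) ^ n"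
proof -
  \<comment> \<open>This parameter minimises the Chernoff bound up to a factor \<open>C ^ n\<close>.\<close>
  define \<theta> where "\<theta> = n / lam"
  have \<theta>: "\<theta> > 0" "\<theta> * lam = n" using assms lam_pos by (auto simp: \<theta>_def)
  have "emeasure M {\<omega> \<in> space M. (\<Sum>j<n. e j \<omega>) \<le> lam}
      = (\<integral>\<^sup>+ \<omega>. indicator {\<omega> \<in> space M. (\<Sum>j<n. e j \<omega>) \<le> lam} \<omega> \<partial>M)"
    by simp
  also have "\<dots> \<le> (\<integral>\<^sup>+ \<omega>. ennreal (exp n) * (\<Prod>j<n. ennreal (exp (- \<theta> * e j \<omega>))) \<partial>M)"
  proof (rule nn_integral_mono)
    fix \<omega>
    have "1 \<le> exp n * (\<Prod>j<n. exp (- \<theta> * e j \<omega>))" if "(\<Sum>j<n. e j \<omega>) \<le> lam"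
    proof -
      have "\<theta> * (\<Sum>j<n. e j \<omega>) \<le> n" using that \<theta> mult_left_mono[OF that, of \<theta>] by simp
      then have "1 \<le> exp (n + (\<Sum>j<n. - \<theta> * e j \<omega>))"
        by (simp add: sum_distrib_left sum_negf)
      then show ?thesis by (simp add: exp_add exp_sum)
    qed
    then show "indicator {\<omega> \<in> space M. (\<Sum>j<n. e j \<omega>) \<le> lam} \<omega>
        \<le> ennreal (exp n) * (\<Prod>j<n. ennreal (exp (- \<theta> * e j \<omega>)))"
      by (auto simp: indicator_def prod_ennreal prod_nonneg simp flip: ennreal_mult)
  qed
  also have "\<dots> = ennreal (exp n) * (\<Prod>j<n. \<integral>\<^sup>+ \<omega>. ennreal (exp (- \<theta> * e j \<omega>)) \<partial>M)"
  proof (subst nn_integral_cmult, measurable, subst indep_vars_nn_integral)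
    show "indep_vars (\<lambda>_. borel) (\<lambda>j \<omega>. ennreal (exp (- \<theta> * e j \<omega>))) {..<n}"
      by (rule indep_vars_compose2[where X=e and Y="\<lambda>j x. ennreal (exp (- \<theta> * x))" and M'="\<lambda>_. borel"])
        (auto intro: indep_vars_subset[OF indep_e])
  qed auto
  also have "\<dots> = ennreal (exp n * (1 / (1 + \<theta>)) ^ n)"
    using \<theta> nn_integral_exp_e[of \<theta>] by (simp add: ennreal_mult ennreal_power)
  also have "\<dots> \<le> ennreal (exp n * (lam / n) ^ n)"
    using lam_pos assms \<theta> by (intro ennreal_leI mult_left_mono power_mono) (auto simp: \<theta>_def field_simps)
  also have "exp n * (lam / n) ^ n = (exp 1 * lam / n) ^ n"
    by (simp add: power_mult_distrib power_divide flip: exp_of_nat_mult)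
  finally show ?thesis
    using lam_pos by (simp add: emeasure_eq_measure)
qed

text \<open>No explosion: infinitely many arrivals by time 1 would lie in the Chernoff event for
  every \<open>n\<close>, and these bounds tend to 0.\<close>

lemma AE_ex_sum_e_gt: "AE \<omega> in M. \<exists>n. lam < (\<Sum>j<n. e j \<omega>)"
proof -
  let ?A = "{\<omega> \<in> space M. \<forall>n. (\<Sum>j<n. e j \<omega>) \<le> lam}"
  have "(\<lambda>n. (exp 1 * lam / n) ^ n) \<longlonglongrightarrow> 0"
  proof (rule tendsto_sandwich[OF _ _ tendsto_const])
    show "(\<lambda>n. (1 / 2 :: real) ^ n) \<longlonglongrightarrow> 0" by (rule LIMSEQ_power_zero) simp
    show "\<forall>\<^sub>F n in sequentially. (exp 1 * lam / real n) ^ n \<le> (1 / 2) ^ n"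
      using eventually_ge_at_top[of "nat \<lceil>2 * exp 1 * lam\<rceil> + 1"]
    proof eventually_elim
      case (elim n)
      then have "2 * exp 1 * lam \<le> n" "n \<ge> 1" by linarith+
      then show ?case using lam_pos by (intro power_mono) (auto simp: field_simps)
    qed
  qed (use lam_pos in auto)
  moreover have "prob ?A \<le> (exp 1 * lam / n) ^ n" if "n \<ge> 1" for n
    by (rule order_trans[OF finite_measure_mono prob_sum_e_le[OF that]]) auto
  ultimately have "prob ?A \<le> 0"
    by (intro LIMSEQ_le_const) (auto intro: exI[of _ 1])
  then have "emeasure M ?A = 0" by (simp add: emeasure_eq_measure measure_le_0_iff)
  then show ?thesis
    by (subst AE_iff_measurable[OF _ refl]) (auto simp: not_less)
qed

end

subsection \<open>Lower bound for the quantization error\<close>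

lemma epow_ennreal: "0 \<le> x \<Longrightarrow> epow (ennreal x) p = ennreal (x powr p)"
  by (simp add: epow_def)

lemma epow_mono: "x \<le> y \<Longrightarrow> 0 \<le> p \<Longrightarrow> epow x p \<le> epow y p"
  unfolding epow_def
  by (auto simp: top_unique less_top intro!: ennreal_leI powr_mono2 enn2real_mono)

text \<open>If no codeword sees more than a fraction \<open>1 / (2 exp r)\<close> of the event \<open>G\<close> within distance
  \<open>\<epsilon>\<close>, then at least half of \<open>G\<close> is at distance \<open>\<epsilon>\<close> from every codebook.\<close>

lemma (in prob_space) quant_err_ge_small_ball:
  assumes s: "0 < s" and \<epsilon>: "0 \<le> \<epsilon>" and G: "G \<in> sets M"
    and ball: "\<And>a. a \<in> A \<Longrightarrow> \<exists>E\<in>sets M. {\<omega>\<in>G. \<rho> (V \<omega>) a \<le> ennreal \<epsilon>} \<subseteq> E \<and> prob E \<le> q"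
    and q: "exp r * q \<le> prob G / 2"
  shows "ennreal (\<epsilon> * (prob G / 2) powr (1 / s)) \<le> quant_err M V \<rho> A s r"
  unfolding quant_err_def
proof (rule INF_greatest, clarify)
  fix C assume C: "finite C" "C \<noteq> {}" "C \<subseteq> A" "ln (real (card C)) \<le> r"
  \<comment> \<open>Measurable covers of the balls suffice for the union bound below, so the balls
    themselves may be nonmeasurable.\<close>
  from ball C have "\<forall>a\<in>C. \<exists>E. E \<in> sets M \<and> {\<omega>\<in>G. \<rho> (V \<omega>) a \<le> ennreal \<epsilon>} \<subseteq> E \<and> prob E \<le> q"
    by blast
  from bchoice[OF this] obtain E where E: "\<And>a. a \<in> C \<Longrightarrow> E a \<in> sets M"
    "\<And>a. a \<in> C \<Longrightarrow> {\<omega>\<in>G. \<rho> (V \<omega>) a \<le> ennreal \<epsilon>} \<subseteq> E a" "\<And>a. a \<in> C \<Longrightarrow> prob (E a) \<le> q"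
    by blast
  have q0: "0 \<le> q" using E(3) C(2) measure_nonneg order_trans by blast
  have U: "(\<Union>a\<in>C. E a) \<in> sets M" using C E by (intro sets.finite_UN) auto
  have "card C > 0" using C by (simp add: card_gt_0_iff)
  then have "real (card C) \<le> exp r" using C(4) by (metis exp_le_cancel_iff exp_ln of_nat_0_less_iff)
  have "prob (\<Union>a\<in>C. E a) \<le> (\<Sum>a\<in>C. prob (E a))"
    using C E by (intro finite_measure_subadditive_finite) auto
  also have "\<dots> \<le> (\<Sum>a\<in>C. q)" by (intro sum_mono E)
  also have "\<dots> \<le> exp r * q"
    using \<open>real (card C) \<le> exp r\<close> q0 by (simp add: mult_right_mono)
  finally have "prob G / 2 \<le> prob G - prob (\<Union>a\<in>C. E a)" using q by simp
  also have "\<dots> \<le> prob (G - (\<Union>a\<in>C. E a))"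
    using measure_Un_le[of "G - (\<Union>a\<in>C. E a)" M "\<Union>a\<in>C. E a"] G U
      finite_measure_mono[of G "(G - (\<Union>a\<in>C. E a)) \<union> (\<Union>a\<in>C. E a)"] by auto
  finally have half: "prob G / 2 \<le> prob (G - (\<Union>a\<in>C. E a))" .
  have "ennreal (\<epsilon> powr s * (prob G / 2)) \<le> ennreal (\<epsilon> powr s) * emeasure M (G - (\<Union>a\<in>C. E a))"
    using mult_left_mono[OF half, of "\<epsilon> powr s"] by (simp add: emeasure_eq_measure ennreal_mult[symmetric])
  also have "\<dots> = (\<integral>\<^sup>+\<omega>. ennreal (\<epsilon> powr s) * indicator (G - (\<Union>a\<in>C. E a)) \<omega> \<partial>M)"
    using G U by (simp add: nn_integral_cmult_indicator)
  also have "\<dots> \<le> (\<integral>\<^sup>+\<omega>. epow (INF a\<in>C. \<rho> (V \<omega>) a) s \<partial>M)"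
  proof (rule nn_integral_mono)
    fix \<omega>
    have "ennreal \<epsilon> \<le> (INF a\<in>C. \<rho> (V \<omega>) a)" if "\<omega> \<in> G - (\<Union>a\<in>C. E a)"
    proof (rule INF_greatest)
      fix a assume "a \<in> C"
      then have "\<not> \<rho> (V \<omega>) a \<le> ennreal \<epsilon>" using that E(2)[of a] by blast
      then show "ennreal \<epsilon> \<le> \<rho> (V \<omega>) a" by simp
    qed
    then have "ennreal (\<epsilon> powr s) \<le> epow (INF a\<in>C. \<rho> (V \<omega>) a) s" if "\<omega> \<in> G - (\<Union>a\<in>C. E a)"
      using that epow_mono[of "ennreal \<epsilon>" _ s] s \<epsilon> by (simp add: epow_ennreal)
    then show "ennreal (\<epsilon> powr s) * indicator (G - (\<Union>a\<in>C. E a)) \<omega> \<le> epow (INF a\<in>C. \<rho> (V \<omega>) a) s"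
      by (auto simp: indicator_def)
  qed
  finally have "epow (ennreal (\<epsilon> powr s * (prob G / 2))) (1 / s)
      \<le> epow (\<integral>\<^sup>+\<omega>. epow (INF a\<in>C. \<rho> (V \<omega>) a) s \<partial>M) (1 / s)"
    using s by (intro epow_mono) auto
  also have "epow (ennreal (\<epsilon> powr s * (prob G / 2))) (1 / s) = ennreal (\<epsilon> * (prob G / 2) powr (1 / s))"
    using s \<epsilon> powr_mult[of "\<epsilon> powr s" "prob G / 2" "1 / s"] by (simp add: epow_ennreal powr_powr)
  finally show "ennreal (\<epsilon> * (prob G / 2) powr (1 / s))
      \<le> epow (\<integral>\<^sup>+\<omega>. epow (INF a\<in>C. \<rho> (V \<omega>) a) s \<partial>M) (1 / s)" .
qed

context compound_poisson
begin

text \<open>Up to a factor \<open>C ^ n\<close> this event has the probability of \<open>n\<close> jumps, namely \<open>n powr - n\<close>, and on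
  it the path determines jump times and jumps in a stable way.\<close>

definition spread_jumps :: "nat \<Rightarrow> (real^'d) set \<Rightarrow> 'w set" where
  "spread_jumps n B = {\<omega> \<in> space M. (\<forall>j. 0 \<le> e j \<omega>) \<and> (\<forall>k<n. e k \<omega> \<in> {lam / (4 * real n)..lam / (2 * real n)})
     \<and> lam \<le> e n \<omega> \<and> (\<forall>k<n. Z k \<omega> \<in> B)}"

lemma spread_jumps_sets [measurable]:
  assumes [measurable]: "B \<in> sets borel"
  shows "spread_jumps n B \<in> sets M"
  unfolding spread_jumps_def by measurable

text \<open>Each of the first \<open>n\<close> waiting times must hit a window of length
  \<open>lam / (4 * n)\<close> inside \<open>{0..lam}\<close>, where the density is at least
  \<open>exp (- lam)\<close>; this is the factor \<open>1 / n\<close> per jump. The final long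
  waiting time costs one further \<open>exp (- lam)\<close>.\<close>

lemma prob_spread_jumps_ge:
  assumes n: "n \<ge> 1" and B [measurable]: "B \<in> sets borel"
  shows "(lam * exp (- lam) * measure (distr M borel (Z 0)) B / (4 * real n)) ^ n * exp (- lam)
    \<le> prob (spread_jumps n B)"
proof -
  define J where "J k = (if k < n then {lam / (4 * real n)..lam / (2 * real n)} else {lam..})" for k
  have Jm [measurable]: "J k \<in> sets borel" for k by (simp add: J_def)
  let ?\<beta> = "measure (distr M borel (Z 0)) B"
  \<comment> \<open>Nonnegativity is part of the event to control \<open>cpp\<close> pointwise; it
    holds almost surely and drops out of the probability.\<close>
  have "prob (spread_jumps n B)
      = prob {\<omega> \<in> space M. (\<forall>k<Suc n. e k \<omega> \<in> J k) \<and> (\<forall>k<n. Z k \<omega> \<in> B)}"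
  proof (rule measure_eq_AE)
    show "AE \<omega> in M. (\<omega> \<in> spread_jumps n B)
      = (\<omega> \<in> {\<omega> \<in> space M. (\<forall>k<Suc n. e k \<omega> \<in> J k) \<and> (\<forall>k<n. Z k \<omega> \<in> B)})"
      using AE_e_nonneg by eventually_elim (auto simp: spread_jumps_def J_def less_Suc_eq)
  qed measurable
  also have "\<dots> = prob {\<omega> \<in> space M. \<forall>k<Suc n. e k \<omega> \<in> J k} * prob {\<omega> \<in> space M. \<forall>k<n. Z k \<omega> \<in> B}"
    by (rule prob_e_and_Z) measurable
  also have "\<dots> = (\<Prod>k<Suc n. prob {\<omega> \<in> space M. e k \<omega> \<in> J k}) * (\<Prod>k<n. ?\<beta>)"
    using B by (simp only: prob_Ball_eq_prod[OF indep_e Jm] prob_Ball_eq_prod[OF indep_Z B] prob_Z_eq)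
  finally have eq: "prob (spread_jumps n B)
      = (\<Prod>k<n. prob {\<omega> \<in> space M. e k \<omega> \<in> J k}) * prob {\<omega> \<in> space M. e n \<omega> \<in> {lam..}} * ?\<beta> ^ n"
    by (simp add: J_def)
  have "(\<Prod>k<n. lam / (4 * real n) * exp (- lam)) \<le> (\<Prod>k<n. prob {\<omega> \<in> space M. e k \<omega> \<in> J k})"
  proof (rule prod_mono)
    fix k assume "k \<in> {..<n}"
    then show "0 \<le> lam / (4 * real n) * exp (- lam) \<and> lam / (4 * real n) * exp (- lam) \<le> prob {\<omega> \<in> space M. e k \<omega> \<in> J k}"
      using prob_e_interval_ge[of "lam / (4 * real n)" "lam / (2 * real n)" k] lam_pos n
      by (auto simp: J_def field_simps)
  qed
  then have "(lam / (4 * real n) * exp (- lam)) ^ n * exp (- lam) * ?\<beta> ^ n \<le> prob (spread_jumps n B)"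
    unfolding eq using lam_pos prob_e_ge_lam[of n] by (intro mult_mono) (auto intro!: prod_nonneg mult_nonneg_nonneg)
  also have "(lam / (4 * real n) * exp (- lam)) ^ n * exp (- lam) * ?\<beta> ^ n
      = (lam * exp (- lam) * ?\<beta> / (4 * real n)) ^ n * exp (- lam)"
    by (simp add: power_mult_distrib power_divide)
  finally show ?thesis .
qed

text \<open>Two sample paths near the same codeword are within \<open>2 * \<epsilon>\<close> of each
  other, and stability applies with spacing \<open>1 / (4 * n)\<close>. Passing from jump times and
  partial sums to increments doubles both errors, which gives the constants 8 and 32.\<close>

lemma spread_jumps_close:
  assumes n: "n \<ge> 1" and \<omega>: "\<omega> \<in> spread_jumps n B" and \<omega>': "\<omega>' \<in> spread_jumps n B"
    and B: "\<And>z. z \<in> B \<Longrightarrow> \<delta> \<le> infnorm z" and a: "a \<in> borel_measurable lborel"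
    and \<epsilon>: "0 \<le> \<epsilon>" "\<epsilon> \<le> \<delta> / (32 * real n)" and \<delta>: "0 < \<delta>"
    and \<rho>: "rho_D (cpp lam e Z \<omega>) a \<le> ennreal \<epsilon>" "rho_D (cpp lam e Z \<omega>') a \<le> ennreal \<epsilon>"
    and k: "k < n"
  shows "\<bar>e k \<omega> - e k \<omega>'\<bar> \<le> 8 * lam * \<epsilon> / \<delta>" "infnorm (Z k \<omega> - Z k \<omega>') \<le> 32 * real n * \<epsilon>"
proof -
  define \<sigma> where "\<sigma> w k = (\<Sum>j<k. e j w) / lam" for w k
  \<comment> \<open>Waiting times of at least \<open>lam / (4 * n)\<close> separate the jump times
    by \<open>h\<close>; their upper limit \<open>lam / (2 * n)\<close> puts all jumps before or at
    time 1/2, so a stretch of length \<open>h\<close> remains after the last one.\<close>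
  define h :: real where "h = 1 / (4 * real n)"
  have h: "0 < h" "h \<le> 1 / 4" using n by (auto simp: h_def field_simps)
  \<comment> \<open>\<open>P\<close> agrees with the path on \<open>{0..<1}\<close> and is
    measurable on the whole line, as the triangle inequality for \<open>rho_D\<close>
    requires.\<close>
  define P where "P w t = (\<Sum>i<n. indicator {(\<Sum>j<Suc i. e j w) / lam..} t *\<^sub>R Z i w)" for w t
  have Pm: "P w \<in> borel_measurable lborel" for w unfolding P_def by measurable
  have *: "\<sigma> w k + h \<le> \<sigma> w (Suc k)" "\<sigma> w k + h \<le> 1"
    "\<And>t. \<sigma> w k \<le> t \<Longrightarrow> t < \<sigma> w (Suc k) \<Longrightarrow> cpp lam e Z w t = (\<Sum>i<k. Z i w)"
    "rho_D (cpp lam e Z w) g = rho_D (P w) g"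
    if w: "w \<in> spread_jumps n B" and k: "k \<le> n" for w k g
  proof -
    have nonneg: "\<And>j. 0 \<le> e j w" using w by (auto simp: spread_jumps_def)
    have last: "lam \<le> e n w" using w by (auto simp: spread_jumps_def)
    have up: "e j w \<le> lam / (2 * real n)" "lam / (4 * real n) \<le> e j w" if "j < n" for j
      using w that by (auto simp: spread_jumps_def)
    have "lam / (4 * real n) \<le> e k w"
    proof (cases "k < n")
      case False
      have "lam / (4 * real n) \<le> lam" using lam_pos n by (simp add: field_simps)
      then show ?thesis using last k False by simp
    qed (use up in auto)
    then show "\<sigma> w k + h \<le> \<sigma> w (Suc k)" using lam_pos n by (simp add: \<sigma>_def h_def field_simps)
    have "(\<Sum>j<k. e j w) \<le> (\<Sum>j<k. lam / (2 * real n))"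
      using up k by (intro sum_mono) auto
    also have "\<dots> = real k * (lam / (2 * real n))" by simp
    also have "\<dots> \<le> real n * (lam / (2 * real n))" using lam_pos k by (intro mult_right_mono) auto
    also have "\<dots> = lam / 2" using n by simp
    finally have "\<sigma> w k \<le> 1 / 2" using lam_pos by (simp add: \<sigma>_def field_simps)
    then show "\<sigma> w k + h \<le> 1" using h by simp
    show "cpp lam e Z w t = (\<Sum>i<k. Z i w)" if "\<sigma> w k \<le> t" "t < \<sigma> w (Suc k)" for t
      using count_proc_eqI[of e w k lam t] nonneg that lam_pos
      by (simp add: cpp_def \<sigma>_def field_simps)
    have "lam \<le> (\<Sum>j<Suc n. e j w)" using last sum_nonneg[of "{..<n}" "\<lambda>j. e j w"] nonneg by simp
    then show "rho_D (cpp lam e Z w) g = rho_D (P w) g"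
      unfolding P_def by (intro rho_D_cong cpp_eq_sum_jumps nonneg lam_pos)
  qed
  have "rho_D (cpp lam e Z \<omega>) (cpp lam e Z \<omega>') = rho_D (P \<omega>) (P \<omega>')"
    using *(4)[OF \<omega>, of 0 "cpp lam e Z \<omega>'"] *(4)[OF \<omega>', of 0 "P \<omega>"]
    by (simp add: rho_D_commute[of "P \<omega>"])
  also have "\<dots> \<le> rho_D (P \<omega>) a + rho_D a (P \<omega>')"
    by (rule rho_D_triangle[OF Pm a Pm])
  also have "\<dots> \<le> ennreal \<epsilon> + ennreal \<epsilon>"
    using \<rho> *(4)[OF \<omega>, of 0] *(4)[OF \<omega>', of 0] by (intro add_mono) (simp_all add: rho_D_commute[of a])
  finally have \<rho>2: "rho_D (cpp lam e Z \<omega>) (cpp lam e Z \<omega>') \<le> ennreal (2 * \<epsilon>)"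
    using \<epsilon> by (simp flip: ennreal_plus)
  have stab: "\<bar>\<sigma> \<omega> k - \<sigma> \<omega>' k\<bar> \<le> 2 * (2 * \<epsilon>) / \<delta>
      \<and> infnorm ((\<Sum>i<k. Z i \<omega>) - (\<Sum>i<k. Z i \<omega>')) \<le> 2 * (2 * \<epsilon>) / h" if "k \<le> n" for k
  proof (rule step_path_stability[where f="cpp lam e Z \<omega>" and f'="cpp lam e Z \<omega>'" and n=n])
    show "2 * \<epsilon> \<le> \<delta> * h / 4" using \<epsilon> by (simp add: h_def)
    show "\<delta> \<le> infnorm (Z k \<omega>)" "\<delta> \<le> infnorm (Z k \<omega>')" if "k < n" for k
      using that \<omega> \<omega>' B by (auto simp: spread_jumps_def)
    show "\<sigma> \<omega> 0 = 0" "\<sigma> \<omega>' 0 = 0" by (simp_all add: \<sigma>_def)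
  qed (fact \<rho>2 \<delta> h(1) that *(1-3)[OF \<omega>] *(1-3)[OF \<omega>'] | use \<epsilon> in simp)+
  have ek: "e k w = lam * (\<sigma> w (Suc k) - \<sigma> w k)" for w using lam_pos by (simp add: \<sigma>_def field_simps)
  have "\<bar>e k \<omega> - e k \<omega>'\<bar> = lam * \<bar>(\<sigma> \<omega> (Suc k) - \<sigma> \<omega>' (Suc k)) - (\<sigma> \<omega> k - \<sigma> \<omega>' k)\<bar>"
    unfolding ek right_diff_distrib[symmetric] abs_mult using lam_pos by (simp add: algebra_simps)
  also have "\<dots> \<le> lam * (4 * \<epsilon> / \<delta> + 4 * \<epsilon> / \<delta>)"
    using stab[of k] stab[of "Suc k"] k lam_pos by (intro mult_left_mono) auto
  finally show "\<bar>e k \<omega> - e k \<omega>'\<bar> \<le> 8 * lam * \<epsilon> / \<delta>" by (simp add: field_simps)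
  let ?S = "\<lambda>k. (\<Sum>i<k. Z i \<omega>) - (\<Sum>i<k. Z i \<omega>')"
  have "infnorm (Z k \<omega> - Z k \<omega>') = infnorm (?S (Suc k) + - ?S k)" by simp
  also have "\<dots> \<le> infnorm (?S (Suc k)) + infnorm (- ?S k)" by (rule infnorm_triangle)
  also have "\<dots> \<le> 4 * \<epsilon> / h + 4 * \<epsilon> / h"
    using stab[of k] stab[of "Suc k"] k unfolding infnorm_neg by (intro add_mono) auto
  finally show "infnorm (Z k \<omega> - Z k \<omega>') \<le> 32 * real n * \<epsilon>" by (simp add: h_def mult_ac)
qed

text \<open>Any outcome \<open>w\<close> in the ball serves as a centre: all others have waiting
  times and jumps close to those of \<open>w\<close>. Independence turns this into a product of
  \<open>n\<close> interval probabilities and \<open>n\<close> cube probabilities, the latter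
  bounded through the density bound \<open>K\<close>.\<close>

lemma small_ball_spread_jumps:
  assumes n: "n \<ge> 1" and [measurable]: "B \<in> sets borel" and B: "\<And>z. z \<in> B \<Longrightarrow> \<delta> \<le> infnorm z"
    and K: "0 \<le> K" "\<And>A. A \<in> sets borel \<Longrightarrow> emeasure (distr M borel (Z 0)) (A \<inter> B) \<le> ennreal K * emeasure lborel A"
    and a: "a \<in> borel_measurable lborel"
    and \<epsilon>: "0 \<le> \<epsilon>" "\<epsilon> \<le> \<delta> / (32 * real n)" and \<delta>: "0 < \<delta>"
  shows "\<exists>E\<in>sets M. {\<omega> \<in> spread_jumps n B. rho_D (cpp lam e Z \<omega>) a \<le> ennreal \<epsilon>} \<subseteq> E
    \<and> prob E \<le> (16 * lam * \<epsilon> / \<delta> * (K * (64 * real n * \<epsilon>) ^ CARD('d))) ^ n"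
proof (cases "{\<omega> \<in> spread_jumps n B. rho_D (cpp lam e Z \<omega>) a \<le> ennreal \<epsilon>} = {}")
  case True
  then show ?thesis using lam_pos \<epsilon> \<delta> K(1) by (intro bexI[of _ "{}"]) auto
next
  case False
  then obtain w where w: "w \<in> spread_jumps n B" "rho_D (cpp lam e Z w) a \<le> ennreal \<epsilon>" by blast
  define c where "c = 8 * lam * \<epsilon> / \<delta>"
  have c: "0 \<le> c" using lam_pos \<epsilon> \<delta> by (simp add: c_def)
  define I where "I k = {e k w - c..e k w + c}" for k
  define Q where "Q k = {z. infnorm (z - Z k w) \<le> 32 * real n * \<epsilon>}" for k
  have [measurable]: "I k \<in> sets borel" "Q k \<in> sets borel" for k by (simp_all add: I_def Q_def)
  have QB: "Q k \<inter> B \<in> sets borel" for k by measurable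
  let ?E = "{\<omega> \<in> space M. (\<forall>k<n. e k \<omega> \<in> I k) \<and> (\<forall>k<n. Z k \<omega> \<in> Q k \<inter> B)}"
  have sub: "{\<omega> \<in> spread_jumps n B. rho_D (cpp lam e Z \<omega>) a \<le> ennreal \<epsilon>} \<subseteq> ?E"
  proof safe
    fix \<omega> k assume \<omega>: "\<omega> \<in> spread_jumps n B" "rho_D (cpp lam e Z \<omega>) a \<le> ennreal \<epsilon>" and k: "k < n"
    note close = spread_jumps_close[OF n \<omega>(1) w(1) B a \<epsilon> \<delta> \<omega>(2) w(2) k]
    show "e k \<omega> \<in> I k" using close(1) by (auto simp: I_def c_def)
    show "Z k \<omega> \<in> Q k" using close(2) by (simp add: Q_def)
  qed (auto simp: spread_jumps_def)
  have "prob ?E = prob {\<omega> \<in> space M. \<forall>k<n. e k \<omega> \<in> I k} * prob {\<omega> \<in> space M. \<forall>k<n. Z k \<omega> \<in> Q k \<inter> B}"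
    by (rule prob_e_and_Z) measurable
  also have "\<dots> = (\<Prod>k<n. prob {\<omega> \<in> space M. e k \<omega> \<in> I k}) * (\<Prod>k<n. measure (distr M borel (Z 0)) (Q k \<inter> B))"
    using QB by (simp only: prob_Ball_eq_prod[OF indep_e] prob_Ball_eq_prod[OF indep_Z QB] prob_Z_eq \<open>\<And>k. I k \<in> sets borel\<close>)
  also have "\<dots> \<le> (\<Prod>k<n. 16 * lam * \<epsilon> / \<delta>) * (\<Prod>k<n. K * (64 * real n * \<epsilon>) ^ CARD('d))"
  proof (intro mult_mono prod_mono conjI)
    fix k
    show "prob {\<omega> \<in> space M. e k \<omega> \<in> I k} \<le> 16 * lam * \<epsilon> / \<delta>"
      using prob_e_interval_le[of "e k w - c" "e k w + c" k] c by (simp add: I_def c_def mult_ac)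
    have "emeasure (distr M borel (Z 0)) (Q k \<inter> B) \<le> ennreal K * emeasure lborel (Q k)"
      by (rule K) simp
    also have "\<dots> \<le> ennreal K * ennreal ((2 * (32 * real n * \<epsilon>)) ^ CARD('d))"
      unfolding Q_def using \<epsilon> by (intro mult_left_mono emeasure_lborel_infnorm_cball_le) auto
    also have "\<dots> = ennreal (K * (64 * real n * \<epsilon>) ^ CARD('d))"
      using K(1) \<epsilon>(1) ennreal_mult[of K "(64 * real n * \<epsilon>) ^ CARD('d)"] by (simp add: mult.assoc)
    finally show "measure (distr M borel (Z 0)) (Q k \<inter> B) \<le> K * (64 * real n * \<epsilon>) ^ CARD('d)"
      unfolding measure_def using K(1) \<epsilon> by (intro enn2real_leI) auto
  qed (use lam_pos \<epsilon> \<delta> K(1) in \<open>auto intro!: prod_nonneg\<close>)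
  also have "\<dots> = (16 * lam * \<epsilon> / \<delta> * (K * (64 * real n * \<epsilon>) ^ CARD('d))) ^ n"
    by (simp only: prod_constant card_lessThan power_mult_distrib)
  finally have "prob ?E \<le> (16 * lam * \<epsilon> / \<delta> * (K * (64 * real n * \<epsilon>) ^ CARD('d))) ^ n" .
  moreover have "?E \<in> sets M" by measurable
  ultimately show ?thesis by (intro bexI[of _ ?E] conjI sub)
qed

text \<open>The radius is chosen so that its power of order \<open>1 + d\<close> contains
  \<open>exp (- r / n)\<close>. The ball probability, an \<open>n\<close>-th power, then contains
  \<open>exp (- r)\<close>, which cancels the number \<open>exp r\<close> of codewords; what remains
  is at most half the probability of the spread event.\<close>

lemma quant_err_ge:
  assumes ac: "has_nonzero_ac_part (distr M borel (Z 0))" and s: "s > 0"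
  obtains c \<kappa> where "c > 0" "\<kappa> > 0"
    "\<And>n r. n \<ge> 1 \<Longrightarrow> r \<ge> 0 \<Longrightarrow>
      ennreal (\<kappa> / real n * exp (- r / (real n * (1 + real CARD('d)))) * ((c / real n) ^ n) powr (1 / s))
      \<le> quant_err M (cpp lam e Z) rho_D (borel_measurable lborel) s r"
proof -
  have "finite_measure (distr M borel (Z 0))"
    by (intro prob_space.finite_measure prob_space_distr measurable_Z)
  from has_nonzero_ac_partE[OF ac this] obtain B \<delta> K
    where B: "B \<in> sets borel" "\<And>z. z \<in> B \<Longrightarrow> \<delta> \<le> infnorm z" "emeasure (distr M borel (Z 0)) B > 0"
      and pos: "0 < \<delta>" "0 < K"
      and K: "\<And>A. A \<in> sets borel \<Longrightarrow> emeasure (distr M borel (Z 0)) (A \<inter> B) \<le> ennreal K * emeasure lborel A"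
    by (metis sets_distr)
  define d where "d = CARD('d)"
  define \<beta> where "\<beta> = measure (distr M borel (Z 0)) B"
  interpret \<mu>: prob_space "distr M borel (Z 0)" by (rule prob_space_distr) simp
  have \<beta>: "\<beta> > 0" using B(3) by (simp add: \<beta>_def \<mu>.emeasure_eq_measure)
  \<comment> \<open>The last factor absorbs the single \<open>exp (- lam)\<close> and the halving of
    the probability into an \<open>n\<close>-th power.\<close>
  define c where "c = lam * exp (- lam) * \<beta> / 4 * (exp (- lam) / 2)"
  define C where "C = 16 * lam / \<delta> * K * 64 ^ d"
  \<comment> \<open>The three bounds serve \<open>\<kappa> ^ Suc d \<le> \<kappa>\<close>, the
    comparison \<open>C * \<kappa> \<le> c\<close>, and the radius condition of the small ball
    estimate.\<close>
  define \<kappa> where "\<kappa> = min 1 (min (c / C) (\<delta> / 32))"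
  have c: "c > 0" "C > 0" using lam_pos \<beta> pos by (simp_all add: c_def C_def)
  then have \<kappa>: "\<kappa> > 0" "\<kappa> \<le> 1" "\<kappa> \<le> c / C" "\<kappa> \<le> \<delta> / 32"
    using pos unfolding \<kappa>_def by (simp_all only: min.cobounded1 min.coboundedI2 min_less_iff_conj) simp_all
  from \<kappa>(3) c have C\<kappa>: "C * \<kappa> \<le> c" by (simp add: field_simps)
  show ?thesis
  proof (rule that[OF c(1) \<kappa>(1)])
    fix n :: nat and r :: real assume n: "n \<ge> 1" and r: "r \<ge> 0"
    define \<epsilon> where "\<epsilon> = \<kappa> / real n * exp (- r / (real n * (1 + real d)))"
    have "\<epsilon> \<le> \<kappa> / real n * 1"
      unfolding \<epsilon>_def using \<kappa> r by (intro mult_left_mono) (auto intro!: divide_nonneg_nonneg)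
    also have "\<dots> \<le> \<delta> / (32 * real n)" using \<kappa>(4) n by (simp add: field_simps)
    finally have \<epsilon>: "0 \<le> \<epsilon>" "\<epsilon> \<le> \<delta> / (32 * real n)" using \<kappa> by (simp_all add: \<epsilon>_def)
    let ?q = "(16 * lam * \<epsilon> / \<delta> * (K * (64 * real n * \<epsilon>) ^ d)) ^ n"
    let ?G = "spread_jumps n B"
    have G: "(c / real n) ^ n \<le> prob ?G / 2"
    proof -
      have "(c / real n) ^ n = (lam * exp (- lam) * \<beta> / (4 * real n)) ^ n * (exp (- lam) / 2) ^ n"
        by (simp add: c_def flip: power_mult_distrib)
      also have "\<dots> \<le> (lam * exp (- lam) * \<beta> / (4 * real n)) ^ n * (exp (- lam) / 2)"
      proof (rule mult_left_mono)
        have "exp (- lam) \<le> 1" using lam_pos by simp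
        then have "exp (- lam) / 2 \<le> 1" by linarith
        then show "(exp (- lam) / 2) ^ n \<le> exp (- lam) / 2"
          using power_decreasing[of 1 n "exp (- lam) / 2"] n by simp
      qed (use lam_pos \<beta> in auto)
      also have "\<dots> \<le> prob ?G / 2"
        using prob_spread_jumps_ge[OF n B(1)] by (simp add: \<beta>_def)
      finally show ?thesis .
    qed
    have "\<epsilon> ^ Suc d = (\<kappa> / real n) ^ Suc d * exp (- r / real n)"
    proof -
      have "exp (- r / (real n * (1 + real d))) ^ Suc d = exp (real (Suc d) * (- r / (real n * (1 + real d))))"
        by (rule exp_of_nat_mult[symmetric])
      also have "\<dots> = exp (- r / real n)"
      proof -
        have "x * (- r / (real n * x)) = - r / real n" if "x > 0" for x :: real
          using that n by (simp add: field_simps)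
        from this[of "1 + real d"] have "real (Suc d) * (- r / (real n * (1 + real d))) = - r / real n"
          by (simp add: add.commute)
        then show ?thesis by simp
      qed
      finally show ?thesis by (simp only: \<epsilon>_def power_mult_distrib)
    qed
    then have "real n ^ d * \<epsilon> ^ Suc d = \<kappa> ^ Suc d / real n * exp (- r / real n)"
      using n by (simp add: power_divide)
    moreover have "16 * lam * \<epsilon> / \<delta> * (K * (64 * real n * \<epsilon>) ^ d) = C * (real n ^ d * \<epsilon> ^ Suc d)"
      by (simp add: C_def power_mult_distrib)
    ultimately have "16 * lam * \<epsilon> / \<delta> * (K * (64 * real n * \<epsilon>) ^ d)
        = C * \<kappa> ^ Suc d / real n * exp (- r / real n)" by simp
    also have "\<dots> \<le> c / real n * exp (- r / real n)"
    proof -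
      have "\<kappa> ^ Suc d \<le> \<kappa>" using \<kappa> power_decreasing[of 1 "Suc d" \<kappa>] by simp
      then have "C * \<kappa> ^ Suc d \<le> c" using C\<kappa> c mult_left_mono[of "\<kappa> ^ Suc d" \<kappa> C] by linarith
      then show ?thesis using n by (intro mult_right_mono divide_right_mono) auto
    qed
    finally have "?q \<le> (c / real n * exp (- r / real n)) ^ n"
      using lam_pos \<epsilon> pos by (intro power_mono) auto
    also have "\<dots> = (c / real n) ^ n * exp (- r)"
      unfolding power_mult_distrib exp_of_nat_mult[symmetric] using n by simp
    finally have "exp r * ?q \<le> exp r * ((c / real n) ^ n * exp (- r))" by simp
    also have "\<dots> = (c / real n) ^ n" by (simp add: exp_minus)
    finally have q: "exp r * ?q \<le> prob ?G / 2" using G by simp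
    have "ennreal (\<epsilon> * (prob ?G / 2) powr (1 / s))
        \<le> quant_err M (cpp lam e Z) rho_D (borel_measurable lborel) s r"
    proof (rule quant_err_ge_small_ball[OF s \<epsilon>(1) _ _ q])
      show "\<exists>E\<in>sets M. {\<omega> \<in> ?G. rho_D (cpp lam e Z \<omega>) a \<le> ennreal \<epsilon>} \<subseteq> E \<and> prob E \<le> ?q"
        if "a \<in> borel_measurable lborel" for a
        using small_ball_spread_jumps[OF n B(1,2) less_imp_le[OF pos(2)] K that \<epsilon> pos(1)] by (simp add: d_def)
    qed (use B in simp)
    moreover have "\<epsilon> * ((c / real n) ^ n) powr (1 / s) \<le> \<epsilon> * (prob ?G / 2) powr (1 / s)"
      using G s c \<epsilon> by (intro mult_left_mono powr_mono2) auto
    ultimately show "ennreal (\<kappa> / real n * exp (- r / (real n * (1 + real CARD('d)))) * ((c / real n) ^ n) powr (1 / s))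
      \<le> quant_err M (cpp lam e Z) rho_D (borel_measurable lborel) s r"
      unfolding \<epsilon>_def d_def by (meson ennreal_leI order_trans)
  qed
qed

end

section \<open>The rate obtained from the lower bound\<close>

text \<open>As \<open>ln (X r)\<close> is asymptotically \<open>ln r / 2\<close>, the term with
  \<open>r / X r\<close> and the term with \<open>X r * ln (X r)\<close> each contribute half of the
  rate. The shift by 1 allows for rounding \<open>X r\<close> up to an integer.\<close>

lemma lower_rate_asymp:
  fixes s u c k :: real
  assumes "s > 0" "u > 0"
  defines "X \<equiv> (\<lambda>r. u * sqrt (r / ln r))"
  shows "((\<lambda>r. (k + ln (X r + 1) + r * u\<^sup>2 / (2 * s * X r) + (X r + 1) / s * (ln (X r + 1) + c))
    / (u / s * sqrt (r * ln r))) \<longlongrightarrow> 1) at_top"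
  unfolding X_def using assms(1,2) by (real_asymp simp: field_simps power2_eq_square)

lemma rate_eq:
  fixes s d r :: real
  assumes "s > 0" "d > 0" "r \<ge> 1"
  shows "sqrt (2 / (s * d) * r * ln r) = sqrt (2 * s / d) / s * sqrt (r * ln r)"
proof -
  have "2 / (s * d) * r * ln r = (2 * s / d) / s\<^sup>2 * (r * ln r)"
    using assms by (simp add: power2_eq_square field_simps)
  then show ?thesis using assms by (simp only: real_sqrt_mult real_sqrt_divide real_sqrt_pow2_iff) simp
qed

lemma neg_eln_le:
  assumes "ennreal x \<le> y" "0 < x"
  shows "- eln (enn2ereal y) \<le> ereal (- ln x)"
proof (cases y)
  case (real v)
  with assms have "x \<le> v" "0 < v" by auto
  then show ?thesis using real assms by (simp add: eln_def enn2ereal_ennreal)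
qed (simp add: eln_def)

lemma neg_eln_ge:
  assumes "y \<le> ennreal x" "0 < x"
  shows "ereal (- ln x) \<le> - eln (enn2ereal y)"
proof (cases y)
  case (real v)
  with assms have "v \<le> x" by auto
  show ?thesis
  proof (cases "v = 0")
    case False
    with real \<open>v \<le> x\<close> show ?thesis by (simp add: eln_def enn2ereal_ennreal)
  qed (use real in \<open>simp add: eln_def zero_ennreal.rep_eq\<close>)
qed (use assms in \<open>simp add: top_unique\<close>)

lemma (in compound_poisson) neg_ln_quant_err_le:
  assumes ac: "has_nonzero_ac_part (distr M borel (Z 0))" and s: "s > 0" and b: "b > 1"
  shows "\<forall>\<^sub>F r in at_top. - eln (enn2ereal (quant_err M (cpp lam e Z) rho_D (borel_measurable lborel) s r))
    \<le> ereal (b * sqrt (2 / (s * (1 + real CARD('d))) * r * ln r))"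
proof -
  from quant_err_ge[OF ac s] obtain c \<kappa> where c: "c > 0" and \<kappa>: "\<kappa> > 0" and
    D: "\<And>n r. n \<ge> 1 \<Longrightarrow> r \<ge> 0 \<Longrightarrow>
      ennreal (\<kappa> / real n * exp (- r / (real n * (1 + real CARD('d)))) * ((c / real n) ^ n) powr (1 / s))
      \<le> quant_err M (cpp lam e Z) rho_D (borel_measurable lborel) s r"
    by metis
  define d where "d = 1 + real CARD('d)"
  have d: "d > 0" by (simp add: d_def)
  define u where "u = sqrt (2 * s / d)"
  have u: "u > 0" "u\<^sup>2 = 2 * s / d" using s d by (simp_all add: u_def)
  \<comment> \<open>The number of jumps that balances \<open>n ln n / s\<close> against \<open>r / (n d)\<close>.\<close>
  define X where "X r = u * sqrt (r / ln r)" for r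
  let ?U = "\<lambda>r. - ln \<kappa> + ln (X r + 1) + r * u\<^sup>2 / (2 * s * X r) + (X r + 1) / s * (ln (X r + 1) + \<bar>ln c\<bar>)"
  have "((\<lambda>r. ?U r / (u / s * sqrt (r * ln r))) \<longlongrightarrow> 1) at_top"
    unfolding X_def by (rule lower_rate_asymp[OF s u(1)])
  then have "\<forall>\<^sub>F r in at_top. ?U r / (u / s * sqrt (r * ln r)) < b"
    using b by (rule order_tendstoD)
  then show ?thesis
    using eventually_gt_at_top[of 1]
  proof eventually_elim
    case (elim r)
    then have "ln r > 0" by simp
    have Xp: "X r > 0" using elim u by (simp add: X_def)
    define n where "n = nat \<lceil>X r\<rceil>"
    have n: "n \<ge> 1" "X r \<le> real n" "real n \<le> X r + 1" using Xp by (auto simp: n_def) linarith+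
    let ?x = "\<kappa> / real n * exp (- r / (real n * d)) * ((c / real n) ^ n) powr (1 / s)"
    have "?x > 0" using \<kappa> c n by simp
    have "- ln ?x = - ln \<kappa> + ln (real n) + r / (real n * d) + real n / s * (ln (real n) - ln c)"
      using \<kappa> c n s by (simp add: ln_mult ln_div ln_powr ln_realpow field_simps)
    \<comment> \<open>The absolute value makes the last summand increasing in \<open>n\<close>, so
      that it can be bounded at \<open>X r + 1\<close>; the decreasing summand is bounded at
      \<open>X r\<close>.\<close>
    also have "\<dots> \<le> - ln \<kappa> + ln (real n) + r / (real n * d) + real n / s * (ln (real n) + \<bar>ln c\<bar>)"
      using s by (intro add_left_mono mult_left_mono) auto
    also have "\<dots> \<le> - ln \<kappa> + ln (X r + 1) + r / (X r * d) + (X r + 1) / s * (ln (X r + 1) + \<bar>ln c\<bar>)"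
      using n Xp elim d s
      by (intro add_mono mult_mono divide_left_mono divide_right_mono mult_right_mono mult_pos_pos) (auto intro!: add_nonneg_nonneg)
    also have "r / (X r * d) = r * u\<^sup>2 / (2 * s * X r)"
      using s Xp d by (simp add: u(2) field_simps)
    finally have 1: "- ln ?x \<le> ?U r" .
    have gp: "u / s * sqrt (r * ln r) > 0" using u s elim by simp
    with elim(1) have 2: "?U r \<le> b * (u / s * sqrt (r * ln r))"
      by (simp only: pos_divide_less_eq less_imp_le)
    have "- eln (enn2ereal (quant_err M (cpp lam e Z) rho_D (borel_measurable lborel) s r)) \<le> ereal (- ln ?x)"
      using D[OF n(1), of r] elim \<open>?x > 0\<close> by (intro neg_eln_le) (simp_all add: d_def)
    also have "\<dots> \<le> ereal (b * (u / s * sqrt (r * ln r)))" using 1 2 by simp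
    also have "u / s * sqrt (r * ln r) = sqrt (2 / (s * d) * r * ln r)"
      unfolding u_def using s d elim by (intro rate_eq[symmetric]) auto
    finally show ?case by (simp add: d_def)
  qed
qed

subsection \<open>Upper bound for the quantization error\<close>

text \<open>Comparison with the largest summand covers \<open>s < 1\<close> and
  \<open>s \<ge> 1\<close> alike, where a convexity argument would need a case distinction.\<close>

lemma powr_sum_le:
  fixes x :: "'i \<Rightarrow> real"
  assumes s: "s > 0" and I: "finite I" and x: "\<And>i. i \<in> I \<Longrightarrow> 0 \<le> x i"
  shows "(\<Sum>i\<in>I. x i) powr s \<le> real (card I) powr s * (\<Sum>i\<in>I. x i powr s)"
proof (cases "I = {}")
  case False
  define m where "m = Max (x ` I)"
  have "m \<in> x ` I" unfolding m_def using I False by (intro Max_in) auto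
  then obtain j where j: "j \<in> I" "m = x j" by blast
  have "(\<Sum>i\<in>I. x i) \<le> (\<Sum>i\<in>I. m)"
    unfolding m_def using I by (intro sum_mono Max_ge) auto
  then have "(\<Sum>i\<in>I. x i) powr s \<le> (real (card I) * m) powr s"
    using s x by (intro powr_mono2) (auto intro: sum_nonneg)
  also have "\<dots> = real (card I) powr s * x j powr s"
    using j x by (simp add: powr_mult)
  also have "\<dots> \<le> real (card I) powr s * (\<Sum>i\<in>I. x i powr s)"
    using j I by (intro mult_left_mono member_le_sum) auto
  finally show ?thesis .
qed simp

lemma powr_add_le:
  fixes x y :: real
  assumes "s > 0" "0 \<le> x" "0 \<le> y"
  shows "(x + y) powr s \<le> 2 powr s * (x powr s + y powr s)"
  using powr_sum_le[of s "UNIV :: bool set" "\<lambda>b. if b then x else y"] assms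
  by (simp add: UNIV_bool add_ac)

text \<open>Real-valued form of the infimum in \<open>quant_err\<close> for finite nonempty
  \<open>C\<close>; as a finite minimum it is attained and measurable in \<open>z\<close>.\<close>

definition dist_to :: "(real^'d) set \<Rightarrow> real^'d \<Rightarrow> real" where
  "dist_to C z = Min ((\<lambda>a. infnorm (z - a)) ` C)"

lemma dist_toE:
  assumes "finite C" "C \<noteq> {}"
  obtains a where "a \<in> C" "dist_to C z = infnorm (z - a)"
proof -
  have "dist_to C z \<in> (\<lambda>a. infnorm (z - a)) ` C"
    unfolding dist_to_def using assms by (intro Min_in) auto
  then show ?thesis using that by blast
qed

lemma dist_to_nonneg: "finite C \<Longrightarrow> C \<noteq> {} \<Longrightarrow> 0 \<le> dist_to C z"
  by (metis dist_toE infnorm_pos_le)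

lemma dist_to_singleton_0: "dist_to {0} z = infnorm z"
  by (simp add: dist_to_def)

lemma INF_dist_inf_eq:
  assumes "finite C" "C \<noteq> {}"
  shows "(INF a\<in>C. dist_inf z a) = ennreal (dist_to C z)"
proof (rule antisym)
  obtain a where "a \<in> C" "dist_to C z = infnorm (z - a)" using dist_toE[OF assms] .
  then show "(INF a\<in>C. dist_inf z a) \<le> ennreal (dist_to C z)"
    by (intro INF_lower2[of a]) (auto simp: dist_inf_def)
  show "ennreal (dist_to C z) \<le> (INF a\<in>C. dist_inf z a)"
    using assms by (intro INF_greatest) (auto simp: dist_inf_def dist_to_def intro!: ennreal_leI Min_le)
qed

lemma borel_measurable_dist_to [measurable]:
  assumes "finite C"
  shows "dist_to C \<in> borel_measurable borel"
  unfolding dist_to_def[abs_def] using assms by (intro borel_measurable_Min) measurable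

text \<open>Turns a bound on the logarithmic ratio at one \<open>\<epsilon>\<close> into an actual
  codebook.\<close>

lemma quant_num_codebookE:
  fixes V :: "'w \<Rightarrow> real^'d"
  assumes s: "s > 0" and \<epsilon>: "0 < \<epsilon>" "\<epsilon> < 1"
    and q: "eln (quant_num M V dist_inf UNIV s \<epsilon>) / ereal (ln (1 / \<epsilon>)) < ereal b"
  obtains C where "finite C" "C \<noteq> {}" "real (card C) \<le> \<epsilon> powr (- b)"
    "(\<integral>\<^sup>+\<omega>. ennreal (dist_to C (V \<omega>) powr s) \<partial>M) \<le> ennreal (2 powr s * \<epsilon> powr s)"
proof -
  let ?q = "quant_num M V dist_inf UNIV s \<epsilon>"
  have L: "ln (1 / \<epsilon>) > 0" using \<epsilon> by simp
  have "?q < ereal (exp (b * ln (1 / \<epsilon>)))"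
  proof (cases ?q)
    case (real v)
    show ?thesis
    proof (cases "v \<le> 0")
      case True
      then show ?thesis unfolding real by (simp add: le_less_trans[OF True])
    next
      case False
      then have "ln v / ln (1 / \<epsilon>) < b" using q L by (simp add: real eln_def)
      then have "ln v < b * ln (1 / \<epsilon>)" using L by (simp only: pos_divide_less_eq)
      then have "exp (ln v) < exp (b * ln (1 / \<epsilon>))" by (simp only: exp_less_cancel_iff)
      then show ?thesis using False by (simp add: real)
    qed
  next
    case PInf
    then show ?thesis using q L by (simp add: eln_def)
  qed simp
  then obtain n where n: "n \<ge> 1" "quant_err M V dist_inf UNIV s (ln (real n)) \<le> ennreal \<epsilon>"
    "real n < exp (b * ln (1 / \<epsilon>))"
    unfolding quant_num_def Inf_less_iff by auto
  \<comment> \<open>The infimum over codebooks need not be attained, so accuracy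
    \<open>\<epsilon>\<close> is relaxed to \<open>2 * \<epsilon>\<close>; this is the origin of
    \<open>2 powr s\<close>.\<close>
  have "ennreal \<epsilon> < ennreal (2 * \<epsilon>)" using \<epsilon> by (intro ennreal_lessI) auto
  with n(2) have "quant_err M V dist_inf UNIV s (ln (real n)) < ennreal (2 * \<epsilon>)" by (rule le_less_trans)
  then obtain C where C: "finite C" "C \<noteq> {}" "ln (real (card C)) \<le> ln (real n)"
    and I: "epow (\<integral>\<^sup>+\<omega>. epow (INF a\<in>C. dist_inf (V \<omega>) a) s \<partial>M) (1 / s) < ennreal (2 * \<epsilon>)"
    unfolding quant_err_def INF_less_iff by auto
  have "card C > 0" using C by (simp add: card_gt_0_iff)
  with C(3) n have "real (card C) \<le> real n" by simp
  also have "\<dots> \<le> \<epsilon> powr (- b)" using n(3) \<epsilon> by (simp add: powr_def ln_div)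
  finally have card: "real (card C) \<le> \<epsilon> powr (- b)" .
  have eq: "(\<integral>\<^sup>+\<omega>. epow (INF a\<in>C. dist_inf (V \<omega>) a) s \<partial>M) = (\<integral>\<^sup>+\<omega>. ennreal (dist_to C (V \<omega>) powr s) \<partial>M)"
    using C by (simp add: INF_dist_inf_eq epow_ennreal dist_to_nonneg)
  have "(\<integral>\<^sup>+\<omega>. ennreal (dist_to C (V \<omega>) powr s) \<partial>M) \<le> ennreal (2 powr s * \<epsilon> powr s)"
  proof (cases "\<integral>\<^sup>+\<omega>. ennreal (dist_to C (V \<omega>) powr s) \<partial>M")
    case (real v)
    then have "v powr (1 / s) < 2 * \<epsilon>" using I \<epsilon> by (simp add: eq epow_ennreal ennreal_less_iff)
    then have "(v powr (1 / s)) powr s \<le> (2 * \<epsilon>) powr s" using s by (intro powr_mono2) auto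
    then have "v \<le> 2 powr s * \<epsilon> powr s" using s real \<epsilon> by (simp add: powr_powr powr_mult)
    then show ?thesis unfolding real by (rule ennreal_leI)
  qed (use I[unfolded eq] in \<open>simp add: epow_def\<close>)
  with C card show ?thesis by (intro that)
qed

section \<open>Product codebooks for whole paths\<close>

definition step_paths :: "nat \<Rightarrow> real \<Rightarrow> (real^'d) set \<Rightarrow> (real \<Rightarrow> real^'d) set" where
  "step_paths n \<epsilon> C = (\<lambda>(\<tau>, z) t. \<Sum>i<n. indicator {\<tau> i..} t *\<^sub>R z i) `
     (({..<n} \<rightarrow>\<^sub>E (\<lambda>k. \<epsilon> * real k) ` {..<nat \<lceil>1 / \<epsilon>\<rceil>}) \<times> ({..<n} \<rightarrow>\<^sub>E C))"

lemma finite_step_paths: "finite C \<Longrightarrow> finite (step_paths n \<epsilon> C)"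
  unfolding step_paths_def by (intro finite_imageI finite_cartesian_product finite_PiE) auto

lemma step_paths_measurable: "step_paths n \<epsilon> C \<subseteq> borel_measurable lborel"
  unfolding step_paths_def by (rule image_subsetI, clarify) measurable

lemma card_step_paths_le:
  assumes C: "finite C" and \<epsilon>: "0 < \<epsilon>" "\<epsilon> \<le> 1"
  shows "real (card (step_paths n \<epsilon> C)) \<le> (2 / \<epsilon> * real (card C)) ^ n"
proof -
  let ?T = "(\<lambda>k. \<epsilon> * real k) ` {..<nat \<lceil>1 / \<epsilon>\<rceil>}"
  have "card ?T \<le> nat \<lceil>1 / \<epsilon>\<rceil>" using card_image_le[of "{..<nat \<lceil>1 / \<epsilon>\<rceil>}"] by simp
  moreover have "0 \<le> 1 / \<epsilon>" using \<epsilon> by simp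
  ultimately have "real (card ?T) \<le> 1 / \<epsilon> + 1" by linarith
  also have "\<dots> \<le> 2 / \<epsilon>" using \<epsilon> by (simp add: field_simps)
  finally have T: "real (card ?T) \<le> 2 / \<epsilon>" .
  have "card (step_paths n \<epsilon> C) \<le> card (({..<n} \<rightarrow>\<^sub>E ?T) \<times> ({..<n} \<rightarrow>\<^sub>E C))"
    unfolding step_paths_def using C by (intro card_image_le finite_cartesian_product finite_PiE) auto
  also have "\<dots> = (card ?T * card C) ^ n"
    by (simp add: card_cartesian_product card_PiE power_mult_distrib)
  finally have "real (card (step_paths n \<epsilon> C)) \<le> (real (card ?T) * real (card C)) ^ n"
    by (metis of_nat_le_iff of_nat_mult of_nat_power)
  also have "\<dots> \<le> (2 / \<epsilon> * real (card C)) ^ n"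
    using T by (intro power_mono mult_right_mono) auto
  finally show ?thesis .
qed

lemma step_paths_approx:
  fixes z :: "nat \<Rightarrow> real^'d"
  assumes C: "finite C" "C \<noteq> {}" and \<epsilon>: "0 < \<epsilon>" and T: "\<And>i. i < n \<Longrightarrow> 0 \<le> T i" "\<And>i. i < n \<Longrightarrow> T i < 1"
  obtains a where "a \<in> step_paths n \<epsilon> C"
    "rho_D (\<lambda>t. \<Sum>i<n. indicator {T i..} t *\<^sub>R z i) a \<le> ennreal (\<Sum>i<n. dist_to C (z i) + \<epsilon> * infnorm (z i))"
proof -
  have "\<forall>i. \<exists>a\<in>C. dist_to C (z i) = infnorm (z i - a)"
  proof
    fix i
    obtain a where "a \<in> C" "dist_to C (z i) = infnorm (z i - a)" by (rule dist_toE[OF C])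
    then show "\<exists>a\<in>C. dist_to C (z i) = infnorm (z i - a)" ..
  qed
  then obtain y where y: "\<And>i. y i \<in> C" "\<And>i. dist_to C (z i) = infnorm (z i - y i)" by metis
  define \<tau> where "\<tau> = restrict (\<lambda>i. \<epsilon> * real (nat \<lfloor>T i / \<epsilon>\<rfloor>)) {..<n}"
  define w where "w = restrict y {..<n}"
  let ?a = "\<lambda>t. \<Sum>i<n. indicator {\<tau> i..} t *\<^sub>R w i"
  \<comment> \<open>Times are rounded down; since \<open>T i < 1\<close>, the index of the grid
    point stays strictly below the number of grid points.\<close>
  have fl: "nat \<lfloor>T i / \<epsilon>\<rfloor> < nat \<lceil>1 / \<epsilon>\<rceil>" "\<bar>T i - \<tau> i\<bar> \<le> \<epsilon>" if i: "i < n" for i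
  proof -
    have x: "0 \<le> T i / \<epsilon>" "T i / \<epsilon> < 1 / \<epsilon>" using T[OF i] \<epsilon> by (auto intro: divide_strict_right_mono)
    then have k: "real (nat \<lfloor>T i / \<epsilon>\<rfloor>) \<le> T i / \<epsilon>" "T i / \<epsilon> < real (nat \<lfloor>T i / \<epsilon>\<rfloor>) + 1"
      by linarith+
    show "nat \<lfloor>T i / \<epsilon>\<rfloor> < nat \<lceil>1 / \<epsilon>\<rceil>" using x k by linarith
    have "\<tau> i \<le> T i" "T i \<le> \<tau> i + \<epsilon>"
      using k \<epsilon> i by (simp_all add: \<tau>_def field_simps)
    then show "\<bar>T i - \<tau> i\<bar> \<le> \<epsilon>" by simp
  qed
  have "?a \<in> step_paths n \<epsilon> C"
    unfolding step_paths_def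
  proof (rule image_eqI[of _ _ "(\<tau>, w)"])
    show "(\<tau>, w) \<in> ({..<n} \<rightarrow>\<^sub>E (\<lambda>k. \<epsilon> * real k) ` {..<nat \<lceil>1 / \<epsilon>\<rceil>}) \<times> ({..<n} \<rightarrow>\<^sub>E C)"
      using fl(1) y(1) by (auto simp del: zless_nat_conj simp: \<tau>_def w_def)
  qed simp
  moreover have "rho_D (\<lambda>t. \<Sum>i<n. indicator {T i..} t *\<^sub>R z i) ?a
      \<le> ennreal (\<Sum>i<n. dist_to C (z i) + \<epsilon> * infnorm (z i))"
    by (rule order_trans[OF rho_D_step_paths_le], rule ennreal_leI, rule sum_mono)
      (use fl(2) y(2) in \<open>auto simp: w_def infnorm_pos_le intro!: mult_right_mono\<close>)
  ultimately show ?thesis by (rule that)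
qed

context compound_poisson
begin

text \<open>The convention \<open>C n = {0}\<close> beyond \<open>m\<close> makes one error formula
  valid for every \<open>n\<close>, whether the path is coded or replaced by the zero path.\<close>

lemma codeword_exists:
  fixes C :: "nat \<Rightarrow> (real^'d) set"
  assumes C: "\<And>n. finite (C n)" "\<And>n. C n \<noteq> {}" and \<epsilon>: "\<And>n. 0 < \<epsilon> n"
    and big: "\<And>n. m < n \<Longrightarrow> C n = {0}"
    and nonneg: "\<And>j. 0 \<le> e j \<omega>" and ex: "\<exists>n. lam < (\<Sum>j<n. e j \<omega>)"
  obtains n a where "a \<in> insert (\<lambda>_. 0) (\<Union>n\<in>{1..m}. step_paths n (\<epsilon> n) (C n))"
    "(\<Sum>j<n. e j \<omega>) \<le> lam"
    "rho_D (cpp lam e Z \<omega>) a \<le> ennreal (\<Sum>i<n. dist_to (C n) (Z i \<omega>) + \<epsilon> n * infnorm (Z i \<omega>))"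
proof -
  \<comment> \<open>The number of arrivals strictly before time 1.\<close>
  define n where "n = (LEAST n. lam \<le> (\<Sum>j<Suc n. e j \<omega>))"
  obtain k where k: "lam < (\<Sum>j<k. e j \<omega>)" using ex by blast
  have "(\<Sum>j<k. e j \<omega>) \<le> (\<Sum>j<Suc k. e j \<omega>)" by (intro partial_sum_mono nonneg) simp
  with k have "lam \<le> (\<Sum>j<Suc k. e j \<omega>)" by linarith
  then have n: "lam \<le> (\<Sum>j<Suc n. e j \<omega>)" unfolding n_def by (rule LeastI)
  have lt: "(\<Sum>j<n. e j \<omega>) < lam"
  proof (cases n)
    case 0
    then show ?thesis using lam_pos by simp
  next
    case (Suc l)
    then have "l < (LEAST n. lam \<le> (\<Sum>j<Suc n. e j \<omega>))" by (simp add: n_def)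
    from not_less_Least[OF this] show ?thesis using Suc by simp
  qed
  define T where "T i = (\<Sum>j<Suc i. e j \<omega>) / lam" for i
  have T: "0 \<le> T i" "T i < 1" if "i < n" for i
  proof -
    show "0 \<le> T i" unfolding T_def using nonneg lam_pos by (intro divide_nonneg_pos sum_nonneg) auto
    have "(\<Sum>j<Suc i. e j \<omega>) \<le> (\<Sum>j<n. e j \<omega>)" using that by (intro partial_sum_mono nonneg) simp
    with lt have "(\<Sum>j<Suc i. e j \<omega>) < lam" by linarith
    then show "T i < 1" using lam_pos by (simp add: T_def)
  qed
  have cpp: "rho_D (cpp lam e Z \<omega>) a = rho_D (\<lambda>t. \<Sum>i<n. indicator {T i..} t *\<^sub>R Z i \<omega>) a" for a
    unfolding T_def by (intro rho_D_cong cpp_eq_sum_jumps nonneg lam_pos n)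
  show ?thesis
  proof (cases "n \<in> {1..m}")
    case True
    obtain a where "a \<in> step_paths n (\<epsilon> n) (C n)"
      "rho_D (\<lambda>t. \<Sum>i<n. indicator {T i..} t *\<^sub>R Z i \<omega>) a
        \<le> ennreal (\<Sum>i<n. dist_to (C n) (Z i \<omega>) + \<epsilon> n * infnorm (Z i \<omega>))"
      by (rule step_paths_approx[where n=n and C="C n" and \<epsilon>="\<epsilon> n" and T=T and z="\<lambda>i. Z i \<omega>"])
        (use C \<epsilon> T in auto)
    then show ?thesis using True lt by (intro that[of a n]) (auto simp: cpp)
  next
    case False
    \<comment> \<open>The zero path is read as a step path with zero jumps at the true jump times,
      so no displacement error arises.\<close>
    have "rho_D (\<lambda>t. \<Sum>i<n. indicator {T i..} t *\<^sub>R Z i \<omega>) (\<lambda>t. \<Sum>i<n. indicator {T i..} t *\<^sub>R (0 :: real^'d))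
      \<le> ennreal (\<Sum>i<n. infnorm (Z i \<omega> - 0) + \<bar>T i - T i\<bar> * infnorm (Z i \<omega>))"
      by (rule rho_D_step_paths_le)
    also have "\<dots> \<le> ennreal (\<Sum>i<n. dist_to (C n) (Z i \<omega>) + \<epsilon> n * infnorm (Z i \<omega>))"
    proof (intro ennreal_leI sum_mono)
      fix i assume "i \<in> {..<n}"
      then have "C n = {0}" using False by (intro big) auto
      then show "infnorm (Z i \<omega> - 0) + \<bar>T i - T i\<bar> * infnorm (Z i \<omega>)
          \<le> dist_to (C n) (Z i \<omega>) + \<epsilon> n * infnorm (Z i \<omega>)"
        using \<epsilon>[of n] by (simp add: dist_to_singleton_0 infnorm_pos_le)
    qed
    finally have "rho_D (cpp lam e Z \<omega>) (\<lambda>_. 0) \<le> ennreal (\<Sum>i<n. dist_to (C n) (Z i \<omega>) + \<epsilon> n * infnorm (Z i \<omega>))"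
      by (simp only: cpp scaleR_zero_right sum.neutral_const)
    then show ?thesis using lt by (intro that[of "\<lambda>_. 0" n]) auto
  qed
qed

text \<open>The error is dominated by a sum over all \<open>n\<close>, each term restricted to an
  event of the waiting times alone; independence then separates it from the jumps. In
  \<open>(2 * n) powr s\<close>, the 2 comes from the two kinds of error and \<open>n\<close> from
  the number of jumps.\<close>

lemma nn_integral_codebook_le:
  fixes C :: "nat \<Rightarrow> (real^'d) set"
  assumes s: "s > 0" and C: "\<And>n. finite (C n)" "\<And>n. C n \<noteq> {}" and \<epsilon>: "\<And>n. 0 < \<epsilon> n"
    and big: "\<And>n. m < n \<Longrightarrow> C n = {0}"
    and K: "0 \<le> K" "(\<integral>\<^sup>+\<omega>. ennreal (infnorm (Z 0 \<omega>) powr s) \<partial>M) \<le> ennreal K"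
      "\<And>n. (\<integral>\<^sup>+\<omega>. ennreal (dist_to (C n) (Z 0 \<omega>) powr s) \<partial>M) \<le> ennreal (K * \<epsilon> n powr s)"
    and D: "D = insert (\<lambda>_. 0) (\<Union>n\<in>{1..m}. step_paths n (\<epsilon> n) (C n))"
  shows "(\<integral>\<^sup>+\<omega>. epow (INF a\<in>D. rho_D (cpp lam e Z \<omega>) a) s \<partial>M)
    \<le> (\<Sum>n. ennreal ((exp 1 * lam / real n) ^ n * ((2 * real n) powr s * (real n * (2 * K * \<epsilon> n powr s)))))"
proof -
  \<comment> \<open>At least \<open>n\<close> arrivals rather than exactly \<open>n\<close>: a
    larger event, but one to which the Chernoff bound applies directly.\<close>
  define A where "A n = {\<omega> \<in> space M. (\<Sum>j<n. e j \<omega>) \<le> lam}" for n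
  have [measurable]: "A n \<in> sets M" for n unfolding A_def by measurable
  note [measurable] = borel_measurable_dist_to[OF C(1)]
  define \<psi> where "\<psi> n z = dist_to (C n) z powr s + \<epsilon> n powr s * infnorm z powr s" for n z
  have \<psi>0: "0 \<le> \<psi> n z" for n z by (simp add: \<psi>_def)
  have [measurable]: "\<psi> n \<in> borel_measurable borel" for n unfolding \<psi>_def[abs_def] by measurable
  let ?c = "\<lambda>n. (2 * real n) powr s"
  have "AE \<omega> in M. epow (INF a\<in>D. rho_D (cpp lam e Z \<omega>) a) s
      \<le> (\<Sum>n. \<Sum>i<n. indicator (A n) \<omega> * ennreal (?c n * \<psi> n (Z i \<omega>)))"
    using AE_e_nonneg AE_ex_sum_e_gt AE_space
  proof eventually_elim
    case (elim \<omega>)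
    obtain n a where a: "a \<in> D" "(\<Sum>j<n. e j \<omega>) \<le> lam"
      "rho_D (cpp lam e Z \<omega>) a \<le> ennreal (\<Sum>i<n. dist_to (C n) (Z i \<omega>) + \<epsilon> n * infnorm (Z i \<omega>))"
      unfolding D by (rule codeword_exists[of C \<epsilon> m \<omega>]) (use C \<epsilon> big elim in auto)
    let ?x = "\<lambda>i. dist_to (C n) (Z i \<omega>)" and ?y = "\<lambda>i. \<epsilon> n * infnorm (Z i \<omega>)"
    have x: "0 \<le> ?x i" "0 \<le> ?y i" for i using dist_to_nonneg[OF C] \<epsilon>[of n] by (auto simp: infnorm_pos_le)
    have "(INF a\<in>D. rho_D (cpp lam e Z \<omega>) a) \<le> ennreal (\<Sum>i<n. ?x i + ?y i)"
      using a by (intro INF_lower2[of a]) auto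
    then have "epow (INF a\<in>D. rho_D (cpp lam e Z \<omega>) a) s \<le> epow (ennreal (\<Sum>i<n. ?x i + ?y i)) s"
      using s by (intro epow_mono) auto
    also have "\<dots> = ennreal ((\<Sum>i<n. ?x i + ?y i) powr s)"
      using x by (intro epow_ennreal sum_nonneg add_nonneg_nonneg)
    also have "\<dots> \<le> ennreal (\<Sum>i<n. ?c n * \<psi> n (Z i \<omega>))"
    proof (rule ennreal_leI)
      have "(\<Sum>i<n. ?x i + ?y i) powr s \<le> real n powr s * (\<Sum>i<n. (?x i + ?y i) powr s)"
        using powr_sum_le[of s "{..<n}" "\<lambda>i. ?x i + ?y i"] s x by simp
      also have "\<dots> \<le> real n powr s * (\<Sum>i<n. 2 powr s * \<psi> n (Z i \<omega>))"
      proof (intro mult_left_mono sum_mono)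
        fix i
        show "(?x i + ?y i) powr s \<le> 2 powr s * \<psi> n (Z i \<omega>)"
          using powr_add_le[OF s x(1)[of i] x(2)[of i]] \<epsilon>[of n] by (simp add: \<psi>_def powr_mult infnorm_pos_le)
      qed simp
      also have "\<dots> = (\<Sum>i<n. ?c n * \<psi> n (Z i \<omega>))"
        by (simp add: powr_mult sum_distrib_left mult_ac)
      finally show "(\<Sum>i<n. ?x i + ?y i) powr s \<le> (\<Sum>i<n. ?c n * \<psi> n (Z i \<omega>))" .
    qed
    also have "\<dots> = (\<Sum>i<n. indicator (A n) \<omega> * ennreal (?c n * \<psi> n (Z i \<omega>)))"
      using a(2) elim \<psi>0 by (simp add: A_def sum_ennreal)
    also have "\<dots> \<le> (\<Sum>n. \<Sum>i<n. indicator (A n) \<omega> * ennreal (?c n * \<psi> n (Z i \<omega>)))"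
      using sum_le_suminf[of "\<lambda>n. \<Sum>i<n. indicator (A n) \<omega> * ennreal (?c n * \<psi> n (Z i \<omega>))" "{n}"]
      by simp
    finally show ?case .
  qed
  then have "(\<integral>\<^sup>+\<omega>. epow (INF a\<in>D. rho_D (cpp lam e Z \<omega>) a) s \<partial>M)
      \<le> (\<integral>\<^sup>+\<omega>. (\<Sum>n. \<Sum>i<n. indicator (A n) \<omega> * ennreal (?c n * \<psi> n (Z i \<omega>))) \<partial>M)"
    by (rule nn_integral_mono_AE)
  also have "\<dots> = (\<Sum>n. \<integral>\<^sup>+\<omega>. (\<Sum>i<n. indicator (A n) \<omega> * ennreal (?c n * \<psi> n (Z i \<omega>))) \<partial>M)"
    by (rule nn_integral_suminf) measurable
  also have "\<dots> = (\<Sum>n. \<Sum>i<n. \<integral>\<^sup>+\<omega>. indicator (A n) \<omega> * ennreal (?c n * \<psi> n (Z i \<omega>)) \<partial>M)"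
    by (intro suminf_cong nn_integral_sum) measurable
  also have "\<dots> \<le> (\<Sum>n. ennreal ((exp 1 * lam / real n) ^ n * (?c n * (real n * (2 * K * \<epsilon> n powr s)))))"
  proof (rule suminf_le)
    fix n
    show "(\<Sum>i<n. \<integral>\<^sup>+\<omega>. indicator (A n) \<omega> * ennreal (?c n * \<psi> n (Z i \<omega>)) \<partial>M)
      \<le> ennreal ((exp 1 * lam / real n) ^ n * (?c n * (real n * (2 * K * \<epsilon> n powr s))))"
    proof (cases "n = 0")
      case False
      have "(\<integral>\<^sup>+\<omega>. ennreal (?c n * \<psi> n (Z 0 \<omega>)) \<partial>M) = ennreal (?c n) * (\<integral>\<^sup>+\<omega>. ennreal (\<psi> n (Z 0 \<omega>)) \<partial>M)"
        using \<psi>0 by (simp add: ennreal_mult nn_integral_cmult)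
      also have "(\<integral>\<^sup>+\<omega>. ennreal (\<psi> n (Z 0 \<omega>)) \<partial>M) = (\<integral>\<^sup>+\<omega>. ennreal (dist_to (C n) (Z 0 \<omega>) powr s) \<partial>M)
          + ennreal (\<epsilon> n powr s) * (\<integral>\<^sup>+\<omega>. ennreal (infnorm (Z 0 \<omega>) powr s) \<partial>M)"
        by (simp add: \<psi>_def ennreal_mult nn_integral_add nn_integral_cmult)
      also have "\<dots> \<le> ennreal (K * \<epsilon> n powr s) + ennreal (\<epsilon> n powr s) * ennreal K"
        by (intro add_mono mult_left_mono K) auto
      also have "\<dots> = ennreal (2 * K * \<epsilon> n powr s)"
        using K(1) by (simp add: ennreal_mult[symmetric] ennreal_plus[symmetric] del: ennreal_plus)
      finally have I: "(\<integral>\<^sup>+\<omega>. ennreal (?c n * \<psi> n (Z 0 \<omega>)) \<partial>M) \<le> ennreal (?c n) * ennreal (2 * K * \<epsilon> n powr s)"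
        by (simp add: mult_left_mono)
      have P: "emeasure M (A n) \<le> ennreal ((exp 1 * lam / real n) ^ n)"
        unfolding A_def emeasure_eq_measure using prob_sum_e_le[of n] False by (intro ennreal_leI) simp
      have "(\<Sum>i<n. \<integral>\<^sup>+\<omega>. indicator (A n) \<omega> * ennreal (?c n * \<psi> n (Z i \<omega>)) \<partial>M)
        = (\<Sum>i<n. emeasure M (A n) * (\<integral>\<^sup>+\<omega>. ennreal (?c n * \<psi> n (Z 0 \<omega>)) \<partial>M))"
        by (intro sum.cong refl nn_integral_indicator_mult_Z[where P="\<lambda>x. (\<Sum>j<n. x j) \<le> lam"])
          (auto simp: A_def)
      also have "\<dots> \<le> (\<Sum>i<n. ennreal ((exp 1 * lam / real n) ^ n) * (ennreal (?c n) * ennreal (2 * K * \<epsilon> n powr s)))"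
        by (intro sum_mono mult_mono P I) auto
      also have "\<dots> = (\<Sum>i<n. ennreal ((exp 1 * lam / real n) ^ n * (?c n * (2 * K * \<epsilon> n powr s))))"
        using K(1) lam_pos by (simp only: ennreal_mult[symmetric] mult_nonneg_nonneg powr_ge_zero zero_le_power
          divide_nonneg_nonneg of_nat_0_le_iff exp_ge_zero less_imp_le zero_le_numeral)
      also have "\<dots> = ennreal (\<Sum>i<n. (exp 1 * lam / real n) ^ n * (?c n * (2 * K * \<epsilon> n powr s)))"
        using K(1) lam_pos by (intro sum_ennreal) auto
      also have "(\<Sum>i<n. (exp 1 * lam / real n) ^ n * (?c n * (2 * K * \<epsilon> n powr s)))
          = (exp 1 * lam / real n) ^ n * (?c n * (real n * (2 * K * \<epsilon> n powr s)))"
        by (simp add: mult_ac)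
      finally show ?thesis .
    qed simp
  qed auto
  finally show ?thesis .
qed

text \<open>The number of jumps is random, so the codebooks for all \<open>n \<le> m\<close> are
  merged. Their sizes add, and the extra 1 counts the zero path.\<close>

lemma quant_err_le_codebooks:
  fixes C :: "nat \<Rightarrow> (real^'d) set"
  assumes s: "s > 0" and C: "\<And>n. finite (C n)" "\<And>n. C n \<noteq> {}" and \<epsilon>: "\<And>n. 0 < \<epsilon> n" "\<And>n. \<epsilon> n \<le> 1"
    and big: "\<And>n. m < n \<Longrightarrow> C n = {0}"
    and K: "0 \<le> K" "(\<integral>\<^sup>+\<omega>. ennreal (infnorm (Z 0 \<omega>) powr s) \<partial>M) \<le> ennreal K"
      "\<And>n. (\<integral>\<^sup>+\<omega>. ennreal (dist_to (C n) (Z 0 \<omega>) powr s) \<partial>M) \<le> ennreal (K * \<epsilon> n powr s)"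
    and r: "1 + (\<Sum>n=1..m. (2 / \<epsilon> n * real (card (C n))) ^ n) \<le> exp r"
  shows "quant_err M (cpp lam e Z) rho_D (borel_measurable lborel) s r
    \<le> epow (\<Sum>n. ennreal ((exp 1 * lam / real n) ^ n * ((2 * real n) powr s * (real n * (2 * K * \<epsilon> n powr s))))) (1 / s)"
proof -
  define U where "U = (\<Union>n\<in>{1..m}. step_paths n (\<epsilon> n) (C n))"
  define D where "D = insert (\<lambda>_. 0) U"
  have fin: "finite U" unfolding U_def using C by (intro finite_UN_I finite_step_paths) auto
  have "card D \<le> 1 + card U" unfolding D_def using fin by (simp add: card_insert_if)
  moreover have "card U \<le> (\<Sum>n=1..m. card (step_paths n (\<epsilon> n) (C n)))"
    unfolding U_def by (rule card_UN_le) simp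
  ultimately have "real (card D) \<le> real (1 + (\<Sum>n=1..m. card (step_paths n (\<epsilon> n) (C n))))"
    by (intro of_nat_mono) linarith
  also have "\<dots> = 1 + (\<Sum>n=1..m. real (card (step_paths n (\<epsilon> n) (C n))))" by simp
  also have "\<dots> \<le> 1 + (\<Sum>n=1..m. (2 / \<epsilon> n * real (card (C n))) ^ n)"
    by (intro add_left_mono sum_mono card_step_paths_le C \<epsilon>)
  finally have "real (card D) \<le> exp r" using r by simp
  moreover have "card D > 0" using fin by (simp add: D_def card_gt_0_iff)
  ultimately have "ln (real (card D)) \<le> ln (exp r)" by (subst ln_le_cancel_iff) auto
  then have "ln (real (card D)) \<le> r" by simp
  moreover have "D \<subseteq> borel_measurable lborel"
    using step_paths_measurable by (auto simp: D_def U_def)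
  ultimately have "quant_err M (cpp lam e Z) rho_D (borel_measurable lborel) s r
      \<le> epow (\<integral>\<^sup>+\<omega>. epow (INF a\<in>D. rho_D (cpp lam e Z \<omega>) a) s \<partial>M) (1 / s)"
    unfolding quant_err_def using fin by (intro INF_lower) (auto simp: D_def)
  also have "\<dots> \<le> epow (\<Sum>n. ennreal ((exp 1 * lam / real n) ^ n
      * ((2 * real n) powr s * (real n * (2 * K * \<epsilon> n powr s))))) (1 / s)"
    using s by (intro epow_mono nn_integral_codebook_le[OF s C \<epsilon>(1) big K]) (auto simp: D_def U_def)
  finally show ?thesis .
qed

text \<open>A finite codebook is bounded, so finite quantization error forces a finite moment. That
  moment controls the displacement error and the paths coded by zero.\<close>

lemma moment_Z_finite:
  assumes s: "s > 0" and C: "finite C" "C \<noteq> {}"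
    and v: "(\<integral>\<^sup>+\<omega>. ennreal (dist_to C (Z 0 \<omega>) powr s) \<partial>M) \<le> ennreal v" "0 \<le> v"
  obtains K where "0 \<le> K" "(\<integral>\<^sup>+\<omega>. ennreal (infnorm (Z 0 \<omega>) powr s) \<partial>M) \<le> ennreal K"
proof -
  define R where "R = Max (infnorm ` C)"
  have R: "infnorm a \<le> R" if "a \<in> C" for a unfolding R_def using C that by (intro Max_ge) auto
  have R0: "0 \<le> R" using R C infnorm_pos_le order_trans by blast
  note [measurable] = borel_measurable_dist_to[OF C(1)]
  have "infnorm z powr s \<le> 2 powr s * (dist_to C z powr s + R powr s)" for z
  proof -
    obtain a where a: "a \<in> C" "dist_to C z = infnorm (z - a)" by (rule dist_toE[OF C])
    have "infnorm z \<le> infnorm (z - a) + infnorm a" using infnorm_triangle[of "z - a" a] by simp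
    also have "\<dots> \<le> dist_to C z + R" using a R[of a] by simp
    finally have "infnorm z powr s \<le> (dist_to C z + R) powr s"
      using s by (intro powr_mono2) (auto simp: infnorm_pos_le)
    also have "\<dots> \<le> 2 powr s * (dist_to C z powr s + R powr s)"
      by (rule powr_add_le[OF s dist_to_nonneg[OF C] R0])
    finally show ?thesis .
  qed
  then have "(\<integral>\<^sup>+\<omega>. ennreal (infnorm (Z 0 \<omega>) powr s) \<partial>M)
      \<le> (\<integral>\<^sup>+\<omega>. ennreal (2 powr s) * (ennreal (dist_to C (Z 0 \<omega>) powr s) + ennreal (R powr s)) \<partial>M)"
    by (intro nn_integral_mono) (simp add: ennreal_mult[symmetric] ennreal_plus[symmetric] ennreal_leI del: ennreal_plus)
  also have "\<dots> = ennreal (2 powr s) * ((\<integral>\<^sup>+\<omega>. ennreal (dist_to C (Z 0 \<omega>) powr s) \<partial>M) + ennreal (R powr s))"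
    by (simp add: nn_integral_cmult nn_integral_add emeasure_space_1)
  also have "\<dots> \<le> ennreal (2 powr s) * (ennreal v + ennreal (R powr s))"
    using v by (intro mult_left_mono add_mono) auto
  also have "\<dots> = ennreal (2 powr s * (v + R powr s))"
    using v by (simp add: ennreal_mult[symmetric] ennreal_plus[symmetric] del: ennreal_plus)
  finally show ?thesis using v by (intro that[of "2 powr s * (v + R powr s)"]) auto
qed

end

section \<open>Estimates uniform in the number of jumps\<close>

text \<open>Giving up the share \<open>\<eta>\<close> of \<open>n ln n\<close> pays for powers of
  \<open>n\<close>, for factors \<open>C ^ n\<close>, and for the \<open>1 / n ^ 2\<close> that
  makes the terms summable.\<close>

lemma jump_count_term_bound:
  fixes lam s \<eta> :: real
  assumes lam: "lam > 0" and \<eta>: "\<eta> > 0"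
  obtains A where "A > 0" "\<And>n. n \<ge> 1 \<Longrightarrow> (exp 1 * lam / real n) ^ n * ((2 * real n) powr s * real n)
    \<le> A / (real n)\<^sup>2 * exp (- (1 - \<eta>) * (real n * ln (real n)))"
proof -
  define f where "f n = exp (3 * ln (real n) + s * ln (2 * real n) + real n * (1 + ln lam) - \<eta> * real n * ln (real n))" for n
  have "f \<longlonglongrightarrow> 0" unfolding f_def[abs_def] using \<eta> by real_asymp
  then have "Bseq f" by (intro convergent_imp_Bseq) (auto simp: convergent_def)
  then obtain A where A: "A > 0" "\<And>n. norm (f n) \<le> A" by (auto simp: Bseq_def)
  show ?thesis
  proof (rule that[OF A(1)])
    fix n :: nat assume n: "n \<ge> 1"
    let ?q = "(1 - \<eta>) * (real n * ln (real n))"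
    have "(exp 1 * lam / real n) ^ n = exp (1 + ln lam - ln (real n)) ^ n"
      using lam n by (simp add: exp_diff exp_add)
    also have "\<dots> = exp (real n * (1 + ln lam - ln (real n)))" by (simp add: exp_of_nat_mult)
    finally have 1: "(exp 1 * lam / real n) ^ n = exp (real n * (1 + ln lam - ln (real n)))" .
    have 2: "(2 * real n) powr s = exp (s * ln (2 * real n))" using n by (simp add: powr_def)
    have 3: "real n ^ 3 = exp (3 * ln (real n))" using n by (simp add: exp_of_nat_mult[of 3, simplified])
    have "(exp 1 * lam / real n) ^ n * ((2 * real n) powr s * real n) * (real n)\<^sup>2 * exp ?q
        = real n ^ 3 * (2 * real n) powr s * (exp 1 * lam / real n) ^ n * exp ?q"
      by (simp add: power2_eq_square power3_eq_cube mult_ac)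
    also have "\<dots> = f n"
      unfolding 1 2 3 f_def exp_add[symmetric] by (simp add: algebra_simps)
    also have "\<dots> \<le> A" using A(2)[of n] by (simp add: f_def)
    finally have "(exp 1 * lam / real n) ^ n * ((2 * real n) powr s * real n) \<le> A / ((real n)\<^sup>2 * exp ?q)"
      using n by (simp add: pos_le_divide_eq mult.assoc)
    also have "\<dots> = A / (real n)\<^sup>2 * exp (- (1 - \<eta>) * (real n * ln (real n)))"
      unfolding minus_mult_left[symmetric] exp_minus by (simp add: divide_inverse)
    finally show "(exp 1 * lam / real n) ^ n * ((2 * real n) powr s * real n)
        \<le> A / (real n)\<^sup>2 * exp (- (1 - \<eta>) * (real n * ln (real n)))" .
  qed
qed

text \<open>Once \<open>n\<close> exceeds \<open>r powr (1 / 2 - \<eta>)\<close>, its logarithm is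
  bounded below by a multiple of \<open>ln r\<close> and the arithmetic-geometric mean inequality
  applies. For smaller \<open>n\<close> the coding term alone is large enough.\<close>

lemma exponent_lower_bound:
  fixes s d \<eta> :: real
  assumes s: "s > 0" and d: "d \<ge> 1" and \<eta>: "0 < \<eta>" "\<eta> < 1 / 4"
  shows "\<forall>\<^sub>F r in at_top. \<forall>n\<ge>1. (1 - 2 * \<eta>) * (s * sqrt (2 / (s * d) * r * ln r))
    \<le> real n * ln (real n) + s * r / ((d + \<eta>) * real n)"
proof -
  have "\<forall>\<^sub>F r in at_top. sqrt (2 / (s * d) * r * ln r) \<le> 1 / (d + \<eta>) * r powr (1 / 2 + \<eta>)"
    using s d \<eta> by real_asymp
  then show ?thesis
    using eventually_gt_at_top[of 1]
  proof eventually_elim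
    case (elim r)
    let ?g = "sqrt (2 / (s * d) * r * ln r)"
    have g0: "0 \<le> ?g" using s d elim by simp
    have lnr: "ln r > 0" using elim by simp
    show ?case
    proof (intro allI impI)
      fix n :: nat assume n: "n \<ge> 1"
      then have lnn: "0 \<le> ln (real n)" by simp
      show "(1 - 2 * \<eta>) * (s * ?g) \<le> real n * ln (real n) + s * r / ((d + \<eta>) * real n)"
      proof (cases "r powr (1 / 2 - \<eta>) \<le> real n")
        case True
        define t where "t = (1 / 2 - \<eta>) * ln r"
        have t: "0 \<le> t" using \<eta> lnr by (simp add: t_def)
        have "ln (r powr (1 / 2 - \<eta>)) \<le> ln (real n)" using True elim n by (subst ln_le_cancel_iff) auto
        then have tn: "t \<le> ln (real n)" using elim by (simp add: t_def ln_powr)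
        \<comment> \<open>In the product \<open>x * y\<close> the factor \<open>n\<close> cancels,
          so \<open>4 * (x * y) \<le> (x + y)\<^sup>2\<close> gives a bound independent of
          \<open>n\<close>.\<close>
        define x y where "x = real n * t" and "y = s * r / ((d + \<eta>) * real n)"
        have xy: "0 \<le> x" "0 \<le> y" using t s d \<eta> elim by (auto simp: x_def y_def)
        have "x * y = t * (s * r / (d + \<eta>))" using n by (simp add: x_def y_def)
        \<comment> \<open>Of the two factors \<open>1 - 2 * \<eta>\<close> in the squared claim, one
          pays for \<open>d + \<eta>\<close> in place of \<open>d\<close>, the other for
          \<open>1 / 2 - \<eta>\<close> in place of \<open>1 / 2\<close>.\<close>
        have "(1 - 2 * \<eta>) * (d + \<eta>) \<le> d"
        proof -
          have "\<eta> * 1 \<le> \<eta> * d" using d \<eta> by (intro mult_left_mono) auto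
          moreover have "0 \<le> \<eta> * \<eta>" by simp
          moreover have "(1 - 2 * \<eta>) * (d + \<eta>) = d + \<eta> - 2 * (\<eta> * d) - 2 * (\<eta> * \<eta>)"
            by (simp add: algebra_simps)
          ultimately show ?thesis using \<eta> by linarith
        qed
        then have dd: "(1 - 2 * \<eta>) / d \<le> 1 / (d + \<eta>)" using d \<eta> by (simp add: field_simps)
        have "((1 - 2 * \<eta>) * (s * ?g))\<^sup>2 = (1 - 2 * \<eta>)\<^sup>2 * (s\<^sup>2 * (2 / (s * d) * r * ln r))"
          using s d elim by (simp add: power_mult_distrib)
        also have "\<dots> = (2 * (1 - 2 * \<eta>) * s * r * ln r) * ((1 - 2 * \<eta>) / d)"
          using s d by (simp add: power2_eq_square field_simps)
        also have "\<dots> \<le> (2 * (1 - 2 * \<eta>) * s * r * ln r) * (1 / (d + \<eta>))"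
          using dd s \<eta> elim by (intro mult_left_mono) auto
        also have "\<dots> = 4 * (x * y)"
        proof -
          have "4 * t = 2 * (1 - 2 * \<eta>) * ln r" by (simp add: t_def algebra_simps)
          then have "4 * (x * y) = 2 * (1 - 2 * \<eta>) * ln r * (s * r / (d + \<eta>))"
            by (simp only: \<open>x * y = t * (s * r / (d + \<eta>))\<close> mult.assoc[symmetric])
          then show ?thesis by (simp add: mult_ac)
        qed
        also have "\<dots> \<le> (x + y)\<^sup>2"
          using sum_squares_bound[of x y] by (simp add: power2_sum)
        finally have "(1 - 2 * \<eta>) * (s * ?g) \<le> x + y"
          by (rule power2_le_imp_le) (use xy in simp)
        also have "x \<le> real n * ln (real n)" unfolding x_def using tn by (intro mult_left_mono) auto
        finally show ?thesis by (simp add: y_def)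
      next
        case False
        have "(1 - 2 * \<eta>) * (s * ?g) \<le> s * ?g"
          using \<eta> s g0 by (intro mult_left_le_one_le) auto
        also have "\<dots> \<le> s * (1 / (d + \<eta>) * r powr (1 / 2 + \<eta>))"
          using elim(1) s by (intro mult_left_mono) auto
        also have "\<dots> \<le> s * (1 / (d + \<eta>) * (r / real n))"
        proof -
          have "r powr (1 / 2 + \<eta>) = r / r powr (1 / 2 - \<eta>)"
            using elim powr_diff[of r 1 "1 / 2 - \<eta>"] by simp
          also have "\<dots> \<le> r / real n"
            using False n elim by (intro divide_left_mono) auto
          finally show ?thesis using s d \<eta> by (intro mult_left_mono) auto
        qed
        also have "\<dots> = s * r / ((d + \<eta>) * real n)" by simp
        also have "\<dots> \<le> real n * ln (real n) + s * r / ((d + \<eta>) * real n)" using lnn by simp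
        finally show ?thesis .
      qed
    qed
  qed
qed

lemma tail_exponent_lower_bound:
  fixes s k :: real
  assumes "s > 0" "k > 0"
  shows "\<forall>\<^sub>F r in at_top. \<forall>n. r powr (2 / 3) \<le> real n \<longrightarrow> s * sqrt (k * r * ln r) \<le> real n * ln (real n)"
proof -
  have "\<forall>\<^sub>F r in at_top. s * sqrt (k * r * ln r) \<le> r powr (2 / 3) * ln (r powr (2 / 3))"
    using assms by real_asymp
  then show ?thesis
    using eventually_gt_at_top[of 1]
  proof eventually_elim
    case (elim r)
    have p: "1 \<le> r powr (2 / 3)" using elim by (intro ge_one_powr_ge_zero) auto
    show ?case
    proof (intro allI impI)
      fix n :: nat assume n: "r powr (2 / 3) \<le> real n"
      have "ln (r powr (2 / 3)) \<le> ln (real n)" using n p by (subst ln_le_cancel_iff) auto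
      then have "r powr (2 / 3) * ln (r powr (2 / 3)) \<le> real n * ln (real n)"
        using n p elim by (intro mult_mono) auto
      with elim(1) show "s * sqrt (k * r * ln r) \<le> real n * ln (real n)" by linarith
    qed
  qed
qed

text \<open>The number of merged codebooks and the factors \<open>2 ^ n\<close> are together
  \<open>exp (o(r))\<close>, which the reserve \<open>\<eta> * r\<close> absorbs.\<close>

lemma codebook_size_bound:
  fixes \<eta> :: real
  assumes "\<eta> > 0"
  shows "\<forall>\<^sub>F r in at_top. 1 + r powr (2 / 3) * (2 powr (r powr (2 / 3)) * exp ((1 - \<eta>) * r)) \<le> exp r"
proof -
  have "\<forall>\<^sub>F r in at_top. r powr (2 / 3) * exp (ln 2 * r powr (2 / 3) - \<eta> * r) \<le> 1 / 2"
    using assms by real_asymp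
  moreover have "\<forall>\<^sub>F r :: real in at_top. exp (- r) \<le> 1 / 2" by real_asymp
  ultimately show ?thesis
  proof eventually_elim
    case (elim r)
    have "1 + r powr (2 / 3) * (2 powr (r powr (2 / 3)) * exp ((1 - \<eta>) * r))
        = exp r * (exp (- r) + r powr (2 / 3) * exp (ln 2 * r powr (2 / 3) - \<eta> * r))"
      by (simp add: powr_def[of 2] distrib_left exp_minus exp_diff algebra_simps exp_add)
    also have "\<dots> \<le> exp r * 1" using elim by (intro mult_left_mono) auto
    finally show ?case by simp
  qed
qed

lemma (in compound_poisson) neg_ln_quant_err_ge:
  assumes s: "s > 0" and b: "b < 1"
    and dim: "Limsup (at_right 0) (\<lambda>\<epsilon>. eln (quant_num M (Z 0) dist_inf UNIV s \<epsilon>) / ereal (ln (1 / \<epsilon>)))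
      = ereal (real CARD('d))"
  shows "\<forall>\<^sub>F r in at_top. ereal (b * sqrt (2 / (s * (1 + real CARD('d))) * r * ln r))
    \<le> - eln (enn2ereal (quant_err M (cpp lam e Z) rho_D (borel_measurable lborel) s r))"
proof -
  define d where "d = real CARD('d)"
  have d: "d > 0" by (simp add: d_def)
  \<comment> \<open>The losses accumulate to
    \<open>(1 - \<eta>) * (1 - 2 * \<eta>) - \<eta>\<close>, which is at least
    \<open>1 - 4 * \<eta>\<close> and hence at least \<open>b\<close>.\<close>
  define \<eta> where "\<eta> = min (1 / 8) ((1 - b) / 4)"
  have "\<eta> \<le> 1 / 8" "\<eta> \<le> (1 - b) / 4" "0 < \<eta>"
    unfolding \<eta>_def using b by (simp_all only: min.cobounded1 min.cobounded2 min_less_iff_conj) simp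
  then have \<eta>: "0 < \<eta>" "\<eta> < 1 / 4" "b \<le> 1 - 4 * \<eta>" by (auto simp: field_simps)
  define g where "g r = sqrt (2 / (s * (1 + d)) * r * ln r)" for r
  have "Limsup (at_right 0) (\<lambda>\<epsilon>. eln (quant_num M (Z 0) dist_inf UNIV s \<epsilon>) / ereal (ln (1 / \<epsilon>))) < ereal (d + \<eta>)"
    unfolding dim d_def using \<eta> by simp
  then have "\<forall>\<^sub>F \<epsilon> in at_right 0. eln (quant_num M (Z 0) dist_inf UNIV s \<epsilon>) / ereal (ln (1 / \<epsilon>)) < ereal (d + \<eta>)"
    by (rule Limsup_lessD)
  then obtain \<epsilon>0 where \<epsilon>0: "\<epsilon>0 > 0" "\<And>\<epsilon>. 0 < \<epsilon> \<Longrightarrow> \<epsilon> < \<epsilon>0 \<Longrightarrow>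
      eln (quant_num M (Z 0) dist_inf UNIV s \<epsilon>) / ereal (ln (1 / \<epsilon>)) < ereal (d + \<eta>)"
    unfolding eventually_at_right_field by auto
  define \<epsilon>1 where "\<epsilon>1 = min \<epsilon>0 1"
  have \<epsilon>1: "\<epsilon>1 > 0" "\<epsilon>1 \<le> 1" using \<epsilon>0 by (auto simp: \<epsilon>1_def)
  have "\<forall>\<epsilon>\<in>{0<..<\<epsilon>1}. \<exists>C. finite C \<and> C \<noteq> {} \<and> real (card C) \<le> \<epsilon> powr (- (d + \<eta>)) \<and>
    (\<integral>\<^sup>+\<omega>. ennreal (dist_to C (Z 0 \<omega>) powr s) \<partial>M) \<le> ennreal (2 powr s * \<epsilon> powr s)"
  proof
    fix \<epsilon> assume "\<epsilon> \<in> {0<..<\<epsilon>1}"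
    then have \<epsilon>: "0 < \<epsilon>" "\<epsilon> < 1" "\<epsilon> < \<epsilon>0" by (auto simp: \<epsilon>1_def)
    obtain C where "finite C" "C \<noteq> {}" "real (card C) \<le> \<epsilon> powr (- (d + \<eta>))"
      "(\<integral>\<^sup>+\<omega>. ennreal (dist_to C (Z 0 \<omega>) powr s) \<partial>M) \<le> ennreal (2 powr s * \<epsilon> powr s)"
      by (rule quant_num_codebookE[OF s \<epsilon>(1,2) \<epsilon>0(2)[OF \<epsilon>(1,3)]])
    then show "\<exists>C. finite C \<and> C \<noteq> {} \<and> real (card C) \<le> \<epsilon> powr (- (d + \<eta>)) \<and>
      (\<integral>\<^sup>+\<omega>. ennreal (dist_to C (Z 0 \<omega>) powr s) \<partial>M) \<le> ennreal (2 powr s * \<epsilon> powr s)"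
      by (intro exI[of _ C] conjI)
  qed
  from bchoice[OF this] obtain Cb where "\<forall>\<epsilon>\<in>{0<..<\<epsilon>1}. finite (Cb \<epsilon>) \<and> Cb \<epsilon> \<noteq> {} \<and>
    real (card (Cb \<epsilon>)) \<le> \<epsilon> powr (- (d + \<eta>)) \<and>
    (\<integral>\<^sup>+\<omega>. ennreal (dist_to (Cb \<epsilon>) (Z 0 \<omega>) powr s) \<partial>M) \<le> ennreal (2 powr s * \<epsilon> powr s)" ..
  then have Cb: "finite (Cb \<epsilon>)" "Cb \<epsilon> \<noteq> {}" "real (card (Cb \<epsilon>)) \<le> \<epsilon> powr (- (d + \<eta>))"
    "(\<integral>\<^sup>+\<omega>. ennreal (dist_to (Cb \<epsilon>) (Z 0 \<omega>) powr s) \<partial>M) \<le> ennreal (2 powr s * \<epsilon> powr s)"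
    if "\<epsilon> \<in> {0<..<\<epsilon>1}" for \<epsilon> using that by simp_all
  have "\<epsilon>1 / 2 \<in> {0<..<\<epsilon>1}" using \<epsilon>1 by simp
  from Cb[OF this] obtain K0 where K0: "0 \<le> K0" "(\<integral>\<^sup>+\<omega>. ennreal (infnorm (Z 0 \<omega>) powr s) \<partial>M) \<le> ennreal K0"
    using moment_Z_finite[OF s, of "Cb (\<epsilon>1 / 2)" "2 powr s * (\<epsilon>1 / 2) powr s"] by auto
  define K where "K = max (2 powr s) K0"
  have K: "0 \<le> K" "2 powr s \<le> K" "K0 \<le> K" using K0 by (auto simp: K_def)
  obtain A where A: "A > 0" "\<And>n. n \<ge> 1 \<Longrightarrow> (exp 1 * lam / real n) ^ n * ((2 * real n) powr s * real n)
    \<le> A / (real n)\<^sup>2 * exp (- (1 - \<eta>) * (real n * ln (real n)))"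
    using jump_count_term_bound[OF lam_pos \<eta>(1), of s] by metis
  define S where "S = (\<Sum>n. inverse (real n ^ 2))"
  have S: "(\<lambda>n. inverse (real n ^ 2)) sums S"
    unfolding S_def by (intro summable_sums inverse_power_summable) simp
  have S0: "0 \<le> S" unfolding S_def using S by (intro suminf_nonneg) (auto simp: sums_iff)
  define W where "W = 2 * K * A * S"
  have W: "0 \<le> W" using K A S0 by (simp add: W_def)
  have k: "2 / (s * (1 + d)) > 0" using s d by simp
  have "\<forall>\<^sub>F r in at_top. c \<le> exp (\<eta> * sqrt (k * r * ln r))" if "k > 0" for c k :: real
    using that \<eta>(1) by real_asymp
  from this[OF k] have "\<forall>\<^sub>F r in at_top. W powr (1 / s) \<le> exp (\<eta> * g r)"
    unfolding g_def .
  moreover have "\<forall>\<^sub>F r in at_top. exp (- ((1 - \<eta>) / (1 + d + \<eta>) * r powr (1 / 3))) < \<epsilon>1"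
  proof -
    have "\<forall>\<^sub>F r in at_top. exp (- (c * r powr (1 / 3))) < \<epsilon>1" if "c > 0" for c :: real
      using that \<epsilon>1(1) by real_asymp
    from this[of "(1 - \<eta>) / (1 + d + \<eta>)"] show ?thesis using \<eta> d by simp
  qed
  moreover have "\<forall>\<^sub>F r in at_top. \<forall>n\<ge>1. (1 - 2 * \<eta>) * (s * g r)
      \<le> real n * ln (real n) + s * r / ((1 + d + \<eta>) * real n)"
    unfolding g_def using exponent_lower_bound[OF s, of "1 + d" \<eta>] d \<eta> by simp
  moreover have "\<forall>\<^sub>F r in at_top. \<forall>n. r powr (2 / 3) \<le> real n \<longrightarrow> s * g r \<le> real n * ln (real n)"
    unfolding g_def by (rule tail_exponent_lower_bound[OF s k])
  moreover note codebook_size_bound[OF \<eta>(1)]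
  moreover note eventually_gt_at_top[of 1]
  ultimately show ?thesis
  proof eventually_elim
    case (elim r)
    note small = elim(2) and head = elim(3) and tail = elim(4) and size = elim(5) and r1 = elim(6)
    have g0: "0 \<le> g r" using k r1 by (simp add: g_def)
    define m where "m = nat \<lfloor>r powr (2 / 3)\<rfloor>"
    \<comment> \<open>One coordinate for the time and \<open>d + \<eta>\<close> for the jump give
      about \<open>\<epsilon> n powr (- (1 + d + \<eta>))\<close> choices per jump, hence
      \<open>exp ((1 - \<eta>) * r)\<close> per path up to \<open>2 ^ n\<close>. Outside
      \<open>{1..m}\<close> the value 1 reduces the error bound to the moment of the jump.\<close>
    define \<epsilon> where "\<epsilon> n = (if n \<in> {1..m} then exp (- ((1 - \<eta>) * r / ((1 + d + \<eta>) * real n))) else 1)" for n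
    define C where "C n = (if n \<in> {1..m} then Cb (\<epsilon> n) else {0})" for n
    have m: "real m \<le> r powr (2 / 3)" unfolding m_def by (simp add: of_nat_floor)
    have \<epsilon>: "0 < \<epsilon> n" "\<epsilon> n \<le> 1" for n using \<eta> d r1 by (auto simp: \<epsilon>_def)
    \<comment> \<open>From \<open>n \<le> r powr (2 / 3)\<close> follows
      \<open>r / n \<ge> r powr (1 / 3)\<close>, so one threshold for \<open>r\<close> makes all
      these accuracies small enough for \<open>Cb\<close>.\<close>
    have \<epsilon>n: "\<epsilon> n \<in> {0<..<\<epsilon>1}" if n: "n \<in> {1..m}" for n
    proof -
      have nn: "1 \<le> real n" "real n \<le> r powr (2 / 3)" using n m by auto
      have "r powr (1 / 3) = r / r powr (2 / 3)" using r1 powr_diff[of r 1 "2 / 3"] by simp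
      also have "\<dots> \<le> r / real n" using nn r1 by (intro divide_left_mono) auto
      finally have "(1 - \<eta>) / (1 + d + \<eta>) * r powr (1 / 3) \<le> (1 - \<eta>) / (1 + d + \<eta>) * (r / real n)"
        using \<eta> d by (intro mult_left_mono) auto
      then have "\<epsilon> n \<le> exp (- ((1 - \<eta>) / (1 + d + \<eta>) * r powr (1 / 3)))"
        using n by (simp add: \<epsilon>_def)
      then show ?thesis using small \<epsilon>(1)[of n] by simp
    qed
    have C: "finite (C n)" "C n \<noteq> {}" for n using Cb(1,2)[OF \<epsilon>n] by (auto simp: C_def)
    have MK: "(\<integral>\<^sup>+\<omega>. ennreal (infnorm (Z 0 \<omega>) powr s) \<partial>M) \<le> ennreal K"
      using K0(2) ennreal_leI[OF K(3)] by (rule order_trans)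
    have CK: "(\<integral>\<^sup>+\<omega>. ennreal (dist_to (C n) (Z 0 \<omega>) powr s) \<partial>M) \<le> ennreal (K * \<epsilon> n powr s)" for n
    proof (cases "n \<in> {1..m}")
      case True
      have "ennreal (2 powr s * \<epsilon> n powr s) \<le> ennreal (K * \<epsilon> n powr s)"
        using K by (intro ennreal_leI mult_right_mono) auto
      with Cb(4)[OF \<epsilon>n[OF True]] show ?thesis using True by (simp add: C_def)
    next
      case False
      then have "C n = {0}" "\<epsilon> n = 1" by (simp_all only: C_def \<epsilon>_def if_False)
      then show ?thesis using MK by (simp add: dist_to_singleton_0)
    qed
    have card: "(2 / \<epsilon> n * real (card (C n))) ^ n \<le> 2 powr (r powr (2 / 3)) * exp ((1 - \<eta>) * r)"
      if n: "n \<in> {1..m}" for n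
    proof -
      have n0: "real n > 0" using n by simp
      have "2 / \<epsilon> n * real (card (C n)) \<le> 2 / \<epsilon> n * \<epsilon> n powr (- (d + \<eta>))"
        using Cb(3)[OF \<epsilon>n[OF n]] n \<epsilon>(1)[of n] by (intro mult_left_mono) (auto simp: C_def)
      also have "\<dots> = 2 * \<epsilon> n powr (- (1 + d + \<eta>))"
      proof -
        have eq: "- (1 + d + \<eta>) = - (d + \<eta>) - 1" by simp
        show ?thesis unfolding eq powr_diff using \<epsilon>(1)[of n] by simp
      qed
      also have "\<epsilon> n powr (- (1 + d + \<eta>)) = exp ((1 - \<eta>) * r / real n)"
      proof -
        have "exp (- (x / (D * y))) powr (- D) = exp (x / y)" if "D > 0" for x y D :: real
          using that by (simp add: powr_def)
        then show ?thesis using n d \<eta> by (simp only: \<epsilon>_def if_True)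
      qed
      finally have "(2 / \<epsilon> n * real (card (C n))) ^ n \<le> (2 * exp ((1 - \<eta>) * r / real n)) ^ n"
        using \<epsilon>(1)[of n] by (intro power_mono) auto
      also have "\<dots> = 2 ^ n * exp ((1 - \<eta>) * r)"
        unfolding power_mult_distrib exp_of_nat_mult[symmetric] using n0 by simp
      also have "(2::real) ^ n = 2 powr real n" by (simp add: powr_realpow)
      also have "2 powr real n * exp ((1 - \<eta>) * r) \<le> 2 powr (r powr (2 / 3)) * exp ((1 - \<eta>) * r)"
        using n m by (intro mult_right_mono powr_mono) auto
      finally show ?thesis .
    qed
    have "(\<Sum>n=1..m. (2 / \<epsilon> n * real (card (C n))) ^ n)
        \<le> (\<Sum>n=1..m. 2 powr (r powr (2 / 3)) * exp ((1 - \<eta>) * r))"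
      by (intro sum_mono card)
    also have "\<dots> = real m * (2 powr (r powr (2 / 3)) * exp ((1 - \<eta>) * r))" by simp
    also have "\<dots> \<le> r powr (2 / 3) * (2 powr (r powr (2 / 3)) * exp ((1 - \<eta>) * r))"
      using m by (intro mult_right_mono) auto
    finally have total: "1 + (\<Sum>n=1..m. (2 / \<epsilon> n * real (card (C n))) ^ n) \<le> exp r"
      using size by linarith
    \<comment> \<open>A bound common to all \<open>n \<ge> 1\<close>: by minimisation over
      \<open>n\<close> up to \<open>m\<close>, by \<open>n ln n\<close> alone beyond. Only the
      factor \<open>1 / n ^ 2\<close> is left to be summed.\<close>
    define Q where "Q = exp (- ((1 - \<eta>) * (1 - 2 * \<eta>) * (s * g r)))"
    have exponent: "exp (- (1 - \<eta>) * (real n * ln (real n))) * \<epsilon> n powr s \<le> Q" if n: "n \<ge> 1" for n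
    proof (cases "n \<le> m")
      case True
      have "exp (- (1 - \<eta>) * (real n * ln (real n))) * \<epsilon> n powr s
          = exp (- ((1 - \<eta>) * (real n * ln (real n) + s * r / ((1 + d + \<eta>) * real n))))"
      proof -
        have "exp (- (1 - \<eta>) * x) * exp (- ((1 - \<eta>) * r / y)) powr s = exp (- ((1 - \<eta>) * (x + s * r / y)))" for x y
          by (simp add: powr_def algebra_simps diff_divide_distrib flip: exp_add)
        then show ?thesis using True n by (simp add: \<epsilon>_def)
      qed
      also have "\<dots> \<le> Q"
        unfolding Q_def mult.assoc using head n \<eta> by (simp add: mult_left_mono)
      finally show ?thesis .
    next
      case False
      then have "r powr (2 / 3) \<le> real n" unfolding m_def by linarith
      then have "s * g r \<le> real n * ln (real n)" using tail by blast
      moreover have "(1 - 2 * \<eta>) * (s * g r) \<le> s * g r"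
        using \<eta> s g0 by (intro mult_left_le_one_le) auto
      ultimately have "(1 - 2 * \<eta>) * (s * g r) \<le> real n * ln (real n)" by linarith
      then have "(1 - \<eta>) * ((1 - 2 * \<eta>) * (s * g r)) \<le> (1 - \<eta>) * (real n * ln (real n))"
        using \<eta> by (intro mult_left_mono) auto
      moreover have "\<epsilon> n = 1" using False by (simp add: \<epsilon>_def)
      ultimately show ?thesis
        by (simp only: powr_one_eq_one mult_1_right mult_minus_left Q_def mult.assoc exp_le_cancel_iff neg_le_iff_le)
    qed
    let ?t = "\<lambda>n. (exp 1 * lam / real n) ^ n * ((2 * real n) powr s * (real n * (2 * K * \<epsilon> n powr s)))"
    have "?t n \<le> 2 * K * A * Q * inverse (real n ^ 2)" for n
    proof (cases "n = 0")
      case False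
      then have n: "n \<ge> 1" by simp
      have "?t n = (exp 1 * lam / real n) ^ n * ((2 * real n) powr s * real n) * (2 * K * \<epsilon> n powr s)"
        by (simp add: mult_ac)
      also have "\<dots> \<le> A / (real n)\<^sup>2 * exp (- (1 - \<eta>) * (real n * ln (real n))) * (2 * K * \<epsilon> n powr s)"
        using K by (intro mult_right_mono A n) auto
      also have "\<dots> = 2 * K * A / (real n)\<^sup>2 * (exp (- (1 - \<eta>) * (real n * ln (real n))) * \<epsilon> n powr s)"
        by (simp add: mult_ac)
      also have "\<dots> \<le> 2 * K * A / (real n)\<^sup>2 * Q"
        using K A by (intro mult_left_mono exponent n) auto
      finally show ?thesis by (simp add: field_simps)
    qed simp
    then have "(\<Sum>n. ennreal (?t n)) \<le> (\<Sum>n. ennreal (2 * K * A * Q * inverse (real n ^ 2)))"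
      by (intro suminf_le ennreal_leI) auto
    also have "\<dots> = ennreal (2 * K * A * Q * S)"
      using K A by (intro suminf_ennreal_eq sums_mult S) (auto simp: Q_def)
    also have "2 * K * A * Q * S = W * Q" by (simp add: W_def mult_ac)
    finally have sum: "(\<Sum>n. ennreal (?t n)) \<le> ennreal (W * Q)" .
    have "quant_err M (cpp lam e Z) rho_D (borel_measurable lborel) s r \<le> epow (\<Sum>n. ennreal (?t n)) (1 / s)"
      by (rule quant_err_le_codebooks[OF s C \<epsilon> _ K(1) MK CK total]) (simp add: C_def)
    also have "\<dots> \<le> epow (ennreal (W * Q)) (1 / s)" using s by (intro epow_mono sum) auto
    also have "\<dots> = ennreal ((W * Q) powr (1 / s))" using W by (intro epow_ennreal) (simp add: Q_def)
    also have "(W * Q) powr (1 / s) = W powr (1 / s) * exp (- ((1 - \<eta>) * (1 - 2 * \<eta>) * g r))"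
      using W s by (simp add: powr_mult Q_def powr_def[of "exp _"])
    also have "ennreal \<dots> \<le> ennreal (exp (- (b * g r)))"
    proof (rule ennreal_leI)
      have "W powr (1 / s) * exp (- ((1 - \<eta>) * (1 - 2 * \<eta>) * g r))
          \<le> exp (\<eta> * g r) * exp (- ((1 - \<eta>) * (1 - 2 * \<eta>) * g r))"
        using elim(1) by (intro mult_right_mono) auto
      also have "\<dots> = exp (- (((1 - \<eta>) * (1 - 2 * \<eta>) - \<eta>) * g r))"
        by (simp add: algebra_simps flip: exp_add)
      also have "\<dots> \<le> exp (- (b * g r))"
      proof -
        have "b \<le> (1 - \<eta>) * (1 - 2 * \<eta>) - \<eta>" 
        proof -
          have "(1 - \<eta>) * (1 - 2 * \<eta>) - \<eta> = 1 - 4 * \<eta> + 2 * (\<eta> * \<eta>)" by (simp add: algebra_simps)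
          then show ?thesis using \<eta>(3) zero_le_square[of \<eta>] by linarith
        qed
        then show ?thesis using g0 by (simp add: mult_right_mono)
      qed
      finally show "W powr (1 / s) * exp (- ((1 - \<eta>) * (1 - 2 * \<eta>) * g r)) \<le> exp (- (b * g r))" .
    qed
    finally have "ereal (- ln (exp (- (b * g r))))
        \<le> - eln (enn2ereal (quant_err M (cpp lam e Z) rho_D (borel_measurable lborel) s r))"
      by (rule neg_eln_ge) simp
    then show ?case by (simp add: g_def d_def)
  qed
qed

theorem theorem6:
  fixes M :: "'w measure" and lam s :: real
    and e :: "nat \<Rightarrow> 'w \<Rightarrow> real" and Z :: "nat \<Rightarrow> 'w \<Rightarrow> real^'d"
  assumes "prob_space M"
    and "lam > 0" and "s > 0"
    and "\<And>j. distributed M lborel (e j) (\<lambda>x. ennreal (exponential_density 1 x))"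
    and "prob_space.indep_vars M (\<lambda>_. borel) e UNIV"
    and "\<And>i. Z i \<in> borel_measurable M"
    and "\<And>i. distr M borel (Z i) = distr M borel (Z 0)"
    and "prob_space.indep_vars M (\<lambda>_. borel) Z UNIV"
    and "prob_space.indep_set M
           (sets (vimage_algebra (space M) (\<lambda>\<omega> j. e j \<omega>) (PiM UNIV (\<lambda>_. borel))))
           (sets (vimage_algebra (space M) (\<lambda>\<omega> i. Z i \<omega>) (PiM UNIV (\<lambda>_. borel))))"
    and "measure M {\<omega> \<in> space M. Z 0 \<omega> = 0} = 0"
    and "has_nonzero_ac_part (distr M borel (Z 0))"
  defines "D \<equiv> (\<lambda>r. quant_err M (cpp lam e Z) rho_D (borel_measurable lborel) s r)"
    and "g \<equiv> (\<lambda>r. sqrt (2 / (s * (1 + real CARD('d))) * r * ln r))"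
  shows "Limsup at_top (\<lambda>r. - eln (enn2ereal (D r)) / ereal (g r)) \<le> 1
         \<and> (Limsup (at_right 0)
               (\<lambda>\<epsilon>. eln (quant_num M (Z 0) dist_inf UNIV s \<epsilon>) / ereal (ln (1 / \<epsilon>)))
             = ereal (real CARD('d))
            \<longrightarrow> ((\<lambda>r. - eln (enn2ereal (D r)) / ereal (g r)) \<longlongrightarrow> 1) at_top)"
proof -
  interpret compound_poisson M lam e Z
    by (intro compound_poisson.intro compound_poisson_axioms.intro) fact+
  let ?f = "\<lambda>r. - eln (enn2ereal (D r)) / ereal (g r)"
  \<comment> \<open>Multiplying out the quotient needs a positive denominator, which is available
    for \<open>r > 1\<close>.\<close>
  have g_pos: "\<forall>\<^sub>F r in at_top. g r > 0"
    using eventually_gt_at_top[of 1] by eventually_elim (use \<open>s > 0\<close> in \<open>auto simp: g_def\<close>)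
  have upper: "\<forall>\<^sub>F r in at_top. ?f r \<le> ereal b" if "b > 1" for b
    using neg_ln_quant_err_le[OF \<open>has_nonzero_ac_part (distr M borel (Z 0))\<close> \<open>s > 0\<close> that] g_pos
  proof eventually_elim
    case (elim r)
    then have "- eln (enn2ereal (D r)) \<le> ereal (g r) * ereal b" by (simp add: D_def g_def mult.commute)
    then show ?case using elim(2) by (subst ereal_divide_le_pos) auto
  qed
  have lower: "\<forall>\<^sub>F r in at_top. ereal b \<le> ?f r" if "b < 1"
    and "Limsup (at_right 0) (\<lambda>\<epsilon>. eln (quant_num M (Z 0) dist_inf UNIV s \<epsilon>) / ereal (ln (1 / \<epsilon>)))
      = ereal (real CARD('d))" for b
    using neg_ln_quant_err_ge[OF \<open>s > 0\<close> that] g_pos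
  proof eventually_elim
    case (elim r)
    then have "ereal (g r) * ereal b \<le> - eln (enn2ereal (D r))" by (simp add: D_def g_def mult.commute)
    then show ?case using elim(2) by (subst ereal_le_divide_pos) auto
  qed
  have "Limsup at_top ?f \<le> 1"
  proof (rule ccontr)
    assume "\<not> ?thesis"
    then have "1 < Limsup at_top ?f" by (simp only: not_le)
    from ereal_dense2[OF this] obtain b where b: "1 < ereal b" "ereal b < Limsup at_top ?f" by blast
    then have "Limsup at_top ?f \<le> ereal b" by (intro Limsup_bounded upper) simp
    with b show False by simp
  qed
  moreover have "(?f \<longlongrightarrow> 1) at_top"
    if dim: "Limsup (at_right 0) (\<lambda>\<epsilon>. eln (quant_num M (Z 0) dist_inf UNIV s \<epsilon>) / ereal (ln (1 / \<epsilon>)))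
      = ereal (real CARD('d))"
  proof (rule order_tendstoI)
    fix a :: ereal assume "a < 1"
    then obtain b where b: "a < ereal b" "ereal b < 1" using ereal_dense2 by blast
    then have "b < 1" by simp
    from lower[OF this dim] show "\<forall>\<^sub>F r in at_top. a < ?f r"
      by eventually_elim (rule less_le_trans[OF b(1)])
  next
    fix a :: ereal assume "1 < a"
    then obtain b where b: "1 < ereal b" "ereal b < a" using ereal_dense2 by blast
    then have "b > 1" by simp
    from upper[OF this] show "\<forall>\<^sub>F r in at_top. ?f r < a"
      by eventually_elim (rule le_less_trans[OF _ b(2)])
  qed
  ultimately show ?thesis by blast
qed

end
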